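(* If $a,d>0$, $b=c=e=0$, and $E_1=E_3$, $\rho_1=\rho_3$, $G_1=G_3$, $I_1=I_3$, $h_1=h_3$, then the evolution system $U_t=\mathcal AU$, $U(0)=U_0$ on $\mathcal H$ is unstable, i.e. the semigroup $(e^{t\mathcal A})_{t\ge0}$ is not strongly stable: there exists $U_0\in\mathcal H$ such that $\|e^{t\mathcal A}U_0\|_{\mathcal H}$ does not tend to $0$ as $t\to+\infty$.
   Context: Fix $L>0$ and constants $\rho_1,\rho_2,\rho_3,h_1,h_2,h_3,E_1,E_3,I_1,I_3,G_1,G_3>0$; write $\rho h:=\rho_1h_1+\rho_2h_2+\rho_3h_3$ and $EI:=E_1I_1+E_3I_3$ (each treated as a single symbol). Let $a,b,c,d,e\ge 0$ be damping coefficients. All functions are complex valued on $(0,L)$ and $\|\cdot\|$ is the $L^2(0,L)$ norm. Energy space: $\mathcal H=(H_0^1\times L^2)^2\times H_0^2\times L^2\times (H_0^1\times L^2)^2$ (spaces on $(0,L)$), with elements $U=(u^1,v^1,y^1,z^1,\omega,\psi,u^3,v^3,y^3,z^3)$. Put $\tau=-u^1+u^3+h_2\omega_x-\frac{h_1}{2}y^1-\frac{h_3}{2}y^3$. $\mathcal H$ is a Hilbert space with the norm $$\|U\|_{\mathcal H}^2=E_1h_1\|u^1_x\|^2+\rho_1h_1\|v^1\|^2+E_3h_3\|u^3_x\|^2+\rho_3h_3\|v^3\|^2+EI\|\omega_{xx}\|^2+\rho h\|\psi\|^2+E_1I_1\|y^1_x\|^2+\rho_1I_1\|z^1\|^2+E_3I_3\|y^3_x\|^2+\rho_3I_3\|z^3\|^2+G_1h_1\|\omega_x+y^1\|^2+\|\tau\|^2+G_3h_3\|\omega_x+y^3\|^2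 .$$ Operator: $D(\mathcal A)=[(H^2\cap H_0^1)\times H_0^1]^2\times (H^4\cap H_0^2)\times H_0^2\times[(H^2\cap H_0^1)\times H_0^1]^2$ and $\mathcal AU$ has the ten components, in order: $v^1$; $(\rho_1h_1)^{-1}[E_1h_1u^1_{xx}+\tau-av^1]$; $z^1$; $(\rho_1I_1)^{-1}[E_1I_1y^1_{xx}+\frac{h_1}{2}\tau-G_1h_1(\omega_x+y^1)-bz^1]$; $\psi$; $(\rho h)^{-1}[-EI\omega_{xxxx}+G_1h_1(\omega_x+y^1)_x+G_3h_3(\omega_x+y^3)_x+h_2\tau_x-c\psi]$; $v^3$; $(\rho_3h_3)^{-1}[E_3h_3u^3_{xx}-\tau-dv^3]$; $z^3$; $(\rho_3I_3)^{-1}[E_3I_3y^3_{xx}+\frac{h_3}{2}\tau-G_3h_3(\omega_x+y^3)-ez^3]$. $\mathcal A$ is m-dissipative and generates a $C_0$-semigroup of contractions $(e^{t\mathcal A})_{t\ge0}$ on $\mathcal H$. *)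

theory Defs
  imports "HOL-Analysis.Analysis"
begin

section \<open>Sobolev spaces on an interval\<close>

text \<open>
  Elements of \<open>L\<^sup>2(0,L)\<close> and of the Sobolev spaces are represented by functions
  \<open>real \<Rightarrow> complex\<close>; only their values almost everywhere on \<open>(0,L)\<close> matter: the
  spaces, norms and weak derivatives below do not change if a function is modified on a null set
  or outside \<open>(0,L)\<close>.
\<close>

abbreviation intv :: "real \<Rightarrow> real measure" where
  "intv L \<equiv> lebesgue_on {0<..<L}"

definition L2 :: "real \<Rightarrow> (real \<Rightarrow> complex) set" where
  "L2 L = {f \<in> borel_measurable (intv L). integrable (intv L) (\<lambda>x. (cmod (f x))\<^sup>2)}"

definition L2_norm :: "real \<Rightarrow> (real \<Rightarrow> complex) \<Rightarrow> real" where
  "L2_norm L f = sqrt (LINT x|intv L. (cmod (f x))\<^sup>2)"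

definition vderiv :: "(real \<Rightarrow> complex) \<Rightarrow> real \<Rightarrow> complex" where
  "vderiv f = (\<lambda>x. vector_derivative f (at x))"

text \<open>\<open>C\<^sub>c\<^sup>\<infinity>(0,L)\<close>; its elements are extended by zero to the real line. A closed set contained in
  \<open>(0,L)\<close> is compact.\<close>

definition test_fun :: "real \<Rightarrow> (real \<Rightarrow> complex) set" where
  "test_fun L = {\<phi>. (\<forall>n x. (vderiv ^^ n) \<phi> differentiable (at x)) \<and>
     closure {x. \<phi> x \<noteq> 0} \<subseteq> {0<..<L}}"

definition is_weak_deriv :: "real \<Rightarrow> (real \<Rightarrow> complex) \<Rightarrow> (real \<Rightarrow> complex) \<Rightarrow> bool" where
  "is_weak_deriv L f g \<longleftrightarrow>
     (\<forall>\<phi>\<in>test_fun L. (LINT x|intv L. f x * vderiv \<phi> x) = - (LINT x|intv L. g x * \<phi> x))"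

primrec sobolev :: "real \<Rightarrow> nat \<Rightarrow> (real \<Rightarrow> complex) set" where
  "sobolev L 0 = L2 L"
| "sobolev L (Suc k) = {f \<in> L2 L. \<exists>g \<in> sobolev L k. is_weak_deriv L f g}"

text \<open>A weak derivative in \<open>L\<^sup>2(0,L)\<close>. It is unique up to null sets where it exists; for functions
  outside \<open>H\<^sup>1(0,L)\<close> the value is arbitrary.\<close>

definition wderiv :: "real \<Rightarrow> (real \<Rightarrow> complex) \<Rightarrow> real \<Rightarrow> complex" where
  "wderiv L f = (SOME g. g \<in> L2 L \<and> is_weak_deriv L f g)"

definition sobolev_norm :: "real \<Rightarrow> nat \<Rightarrow> (real \<Rightarrow> complex) \<Rightarrow> real" where
  "sobolev_norm L k f = sqrt (\<Sum>j\<le>k. (L2_norm L ((wderiv L ^^ j) f))\<^sup>2)"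

text \<open>\<open>H\<^sub>0\<^sup>k(0,L)\<close>: the closure of the test functions in \<open>H\<^sup>k(0,L)\<close>.\<close>

definition sobolev0 :: "real \<Rightarrow> nat \<Rightarrow> (real \<Rightarrow> complex) set" where
  "sobolev0 L k = {f \<in> sobolev L k.
     \<forall>\<epsilon>>0. \<exists>\<phi>\<in>test_fun L. sobolev_norm L k (\<lambda>x. f x - \<phi> x) < \<epsilon>}"


section \<open>The three-layer beam\<close>

record beam =
  len :: real
  rho1 :: real  rho2 :: real  rho3 :: real
  h1 :: real  h2 :: real  h3 :: real
  E1 :: real  E3 :: real
  I1 :: real  I3 :: real
  G1 :: real  G3 :: real
  damp_a :: real  damp_b :: real  damp_c :: real  damp_d :: real  damp_e :: real

definition admissible :: "beam \<Rightarrow> bool" where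
  "admissible p \<longleftrightarrow> 0 < len p
     \<and> 0 < rho1 p \<and> 0 < rho2 p \<and> 0 < rho3 p
     \<and> 0 < h1 p \<and> 0 < h2 p \<and> 0 < h3 p
     \<and> 0 < E1 p \<and> 0 < E3 p \<and> 0 < I1 p \<and> 0 < I3 p \<and> 0 < G1 p \<and> 0 < G3 p
     \<and> 0 \<le> damp_a p \<and> 0 \<le> damp_b p \<and> 0 \<le> damp_c p \<and> 0 \<le> damp_d p \<and> 0 \<le> damp_e p"

definition rho_h :: "beam \<Rightarrow> real" where
  "rho_h p = rho1 p * h1 p + rho2 p * h2 p + rho3 p * h3 p"

definition EI :: "beam \<Rightarrow> real" where
  "EI p = E1 p * I1 p + E3 p * I3 p"

record state =
  u1 :: "real \<Rightarrow> complex"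
  v1 :: "real \<Rightarrow> complex"
  y1 :: "real \<Rightarrow> complex"
  z1 :: "real \<Rightarrow> complex"
  w :: "real \<Rightarrow> complex"
  psi :: "real \<Rightarrow> complex"
  u3 :: "real \<Rightarrow> complex"
  v3 :: "real \<Rightarrow> complex"
  y3 :: "real \<Rightarrow> complex"
  z3 :: "real \<Rightarrow> complex"

text \<open>Equality of the represented elements of the energy space.\<close>

definition state_eq :: "beam \<Rightarrow> state \<Rightarrow> state \<Rightarrow> bool" where
  "state_eq p U V \<longleftrightarrow>
     (\<forall>f\<in>{u1, v1, y1, z1, w, psi, u3, v3, y3, z3}. AE x in intv (len p). f U x = f V x)"

definition lincomb :: "complex \<Rightarrow> state \<Rightarrow> complex \<Rightarrow> state \<Rightarrow> state" where
  "lincomb \<alpha> U \<beta> V =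
     \<lparr> u1 = (\<lambda>x. \<alpha> * u1 U x + \<beta> * u1 V x),
       v1 = (\<lambda>x. \<alpha> * v1 U x + \<beta> * v1 V x),
       y1 = (\<lambda>x. \<alpha> * y1 U x + \<beta> * y1 V x),
       z1 = (\<lambda>x. \<alpha> * z1 U x + \<beta> * z1 V x),
       w = (\<lambda>x. \<alpha> * w U x + \<beta> * w V x),
       psi = (\<lambda>x. \<alpha> * psi U x + \<beta> * psi V x),
       u3 = (\<lambda>x. \<alpha> * u3 U x + \<beta> * u3 V x),
       v3 = (\<lambda>x. \<alpha> * v3 U x + \<beta> * v3 V x),
       y3 = (\<lambda>x. \<alpha> * y3 U x + \<beta> * y3 V x),
       z3 = (\<lambda>x. \<alpha> * z3 U x + \<beta> * z3 V x) \<rparr>"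

abbreviation state_diff :: "state \<Rightarrow> state \<Rightarrow> state" where
  "state_diff U V \<equiv> lincomb 1 U (- 1) V"

definition energy_space :: "beam \<Rightarrow> state set" where
  "energy_space p = {U.
     u1 U \<in> sobolev0 (len p) 1 \<and> v1 U \<in> L2 (len p) \<and>
     y1 U \<in> sobolev0 (len p) 1 \<and> z1 U \<in> L2 (len p) \<and>
     w U \<in> sobolev0 (len p) 2 \<and> psi U \<in> L2 (len p) \<and>
     u3 U \<in> sobolev0 (len p) 1 \<and> v3 U \<in> L2 (len p) \<and>
     y3 U \<in> sobolev0 (len p) 1 \<and> z3 U \<in> L2 (len p)}"

definition tau :: "beam \<Rightarrow> state \<Rightarrow> real \<Rightarrow> complex" where
  "tau p U = (\<lambda>x. - u1 U x + u3 U x + h2 p *\<^sub>R wderiv (len p) (w U) x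
     - (h1 p / 2) *\<^sub>R y1 U x - (h3 p / 2) *\<^sub>R y3 U x)"

definition shear1 :: "beam \<Rightarrow> state \<Rightarrow> real \<Rightarrow> complex" where
  "shear1 p U = (\<lambda>x. wderiv (len p) (w U) x + y1 U x)"

definition shear3 :: "beam \<Rightarrow> state \<Rightarrow> real \<Rightarrow> complex" where
  "shear3 p U = (\<lambda>x. wderiv (len p) (w U) x + y3 U x)"

definition energy_norm :: "beam \<Rightarrow> state \<Rightarrow> real" where
  "energy_norm p U = (let D = wderiv (len p); N = L2_norm (len p) in sqrt (
       E1 p * h1 p * (N (D (u1 U)))\<^sup>2 + rho1 p * h1 p * (N (v1 U))\<^sup>2
     + E3 p * h3 p * (N (D (u3 U)))\<^sup>2 + rho3 p * h3 p * (N (v3 U))\<^sup>2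
     + EI p * (N (D (D (w U))))\<^sup>2 + rho_h p * (N (psi U))\<^sup>2
     + E1 p * I1 p * (N (D (y1 U)))\<^sup>2 + rho1 p * I1 p * (N (z1 U))\<^sup>2
     + E3 p * I3 p * (N (D (y3 U)))\<^sup>2 + rho3 p * I3 p * (N (z3 U))\<^sup>2
     + G1 p * h1 p * (N (shear1 p U))\<^sup>2 + (N (tau p U))\<^sup>2
     + G3 p * h3 p * (N (shear3 p U))\<^sup>2))"

definition dom_A :: "beam \<Rightarrow> state set" where
  "dom_A p = {U.
     u1 U \<in> sobolev (len p) 2 \<inter> sobolev0 (len p) 1 \<and> v1 U \<in> sobolev0 (len p) 1 \<and>
     y1 U \<in> sobolev (len p) 2 \<inter> sobolev0 (len p) 1 \<and> z1 U \<in> sobolev0 (len p) 1 \<and>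
     w U \<in> sobolev (len p) 4 \<inter> sobolev0 (len p) 2 \<and> psi U \<in> sobolev0 (len p) 2 \<and>
     u3 U \<in> sobolev (len p) 2 \<inter> sobolev0 (len p) 1 \<and> v3 U \<in> sobolev0 (len p) 1 \<and>
     y3 U \<in> sobolev (len p) 2 \<inter> sobolev0 (len p) 1 \<and> z3 U \<in> sobolev0 (len p) 1}"

definition op_A :: "beam \<Rightarrow> state \<Rightarrow> state" where
  "op_A p U = (let D = wderiv (len p) in
     \<lparr> u1 = v1 U,
       v1 = (\<lambda>x. (1 / (rho1 p * h1 p)) *\<^sub>R
         ((E1 p * h1 p) *\<^sub>R D (D (u1 U)) x + tau p U x - damp_a p *\<^sub>R v1 U x)),
       y1 = z1 U,
       z1 = (\<lambda>x. (1 / (rho1 p * I1 p)) *\<^sub>R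
         ((E1 p * I1 p) *\<^sub>R D (D (y1 U)) x + (h1 p / 2) *\<^sub>R tau p U x
           - (G1 p * h1 p) *\<^sub>R shear1 p U x - damp_b p *\<^sub>R z1 U x)),
       w = psi U,
       psi = (\<lambda>x. (1 / rho_h p) *\<^sub>R
         (- (EI p *\<^sub>R D (D (D (D (w U)))) x)
           + (G1 p * h1 p) *\<^sub>R D (shear1 p U) x + (G3 p * h3 p) *\<^sub>R D (shear3 p U) x
           + h2 p *\<^sub>R D (tau p U) x - damp_c p *\<^sub>R psi U x)),
       u3 = v3 U,
       v3 = (\<lambda>x. (1 / (rho3 p * h3 p)) *\<^sub>R
         ((E3 p * h3 p) *\<^sub>R D (D (u3 U)) x - tau p U x - damp_d p *\<^sub>R v3 U x)),
       y3 = z3 U,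
       z3 = (\<lambda>x. (1 / (rho3 p * I3 p)) *\<^sub>R
         ((E3 p * I3 p) *\<^sub>R D (D (y3 U)) x + (h3 p / 2) *\<^sub>R tau p U x
           - (G3 p * h3 p) *\<^sub>R shear3 p U x - damp_e p *\<^sub>R z3 U x)) \<rparr>)"


section \<open>Semigroups on the energy space\<close>

text \<open>\<open>S t\<close> is only meaningful for \<open>t \<ge> 0\<close>. Equations between elements of the energy space are
  stated with \<^const>\<open>state_eq\<close>; that \<open>S t\<close> respects it follows from linearity and boundedness.\<close>

definition c0_semigroup :: "beam \<Rightarrow> (real \<Rightarrow> state \<Rightarrow> state) \<Rightarrow> bool" where
  "c0_semigroup p S \<longleftrightarrow>
     (\<forall>t\<ge>0. \<forall>U\<in>energy_space p. S t U \<in> energy_space p) \<and>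
     (\<forall>t\<ge>0. \<forall>\<alpha> \<beta>. \<forall>U\<in>energy_space p. \<forall>V\<in>energy_space p.
        state_eq p (S t (lincomb \<alpha> U \<beta> V)) (lincomb \<alpha> (S t U) \<beta> (S t V))) \<and>
     (\<forall>t\<ge>0. \<exists>M. \<forall>U\<in>energy_space p. energy_norm p (S t U) \<le> M * energy_norm p U) \<and>
     (\<forall>U\<in>energy_space p. state_eq p (S 0 U) U) \<and>
     (\<forall>s\<ge>0. \<forall>t\<ge>0. \<forall>U\<in>energy_space p. state_eq p (S (s + t) U) (S s (S t U))) \<and>
     (\<forall>U\<in>energy_space p. ((\<lambda>t. energy_norm p (state_diff (S t U) U)) \<longlongrightarrow> 0) (at_right 0))"

text \<open>\<open>S\<close> is the semigroup \<open>(e\<^sup>t\<^sup>A)\<close>: the graph of its infinitesimal generator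
  \<open>U \<mapsto> lim (S t U - U) / t\<close> (\<open>t \<rightarrow> 0+\<close>, limit in the energy space) is the graph of \<open>A\<close>.
  In particular the domain of the generator is exactly \<^term>\<open>dom_A p\<close>.\<close>

definition generated_by_A :: "beam \<Rightarrow> (real \<Rightarrow> state \<Rightarrow> state) \<Rightarrow> bool" where
  "generated_by_A p S \<longleftrightarrow> c0_semigroup p S \<and>
     (\<forall>U\<in>energy_space p. \<forall>V\<in>energy_space p.
        ((\<lambda>t. energy_norm p
            (state_diff (lincomb (1 / of_real t) (S t U) (- 1 / of_real t) U) V)) \<longlongrightarrow> 0) (at_right 0)
        \<longleftrightarrow> U \<in> dom_A p \<and> state_eq p V (op_A p U))"

definition strongly_stable :: "beam \<Rightarrow> (real \<Rightarrow> state \<Rightarrow> state) \<Rightarrow> bool" where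
  "strongly_stable p S \<longleftrightarrow>
     (\<forall>U\<^sub>0\<in>energy_space p. ((\<lambda>t. energy_norm p (S t U\<^sub>0)) \<longlongrightarrow> 0) at_top)"

end

theory Submission
  imports Defs
begin

text \<open>
  Rotating the two outer layers in opposite directions, \<open>y\<^sup>1 = - y\<^sup>3\<close>, with everything else at rest
  gives \<open>\<tau> = 0\<close>, and in the symmetric beam the two shear forces on the transverse displacement
  cancel. The damping of
  \<open>v\<^sup>1\<close> and \<open>v\<^sup>3\<close> is then never felt, and \<open>y\<^sup>1\<close> solves a conservative wave equation whose
  eigenfunction \<open>sin (\<pi>x/L)\<close> yields a purely imaginary eigenvalue of the operator. The energy of the
  corresponding orbit is constant: it has right derivative zero, and it is left continuous.
\<close>

section \<open>Smooth functions and cutoffs\<close>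

text \<open>The semigroup is known only through its generator, which is a right limit at time 0. The
  orbit is therefore never identified with e^(i\<omega>t) U. At time h it agrees with e^(i\<omega>h)
  U up to o(h), boundedness of \<open>S t\<close> carries this error to time t, and a factor of
  modulus 1 leaves the norm alone, so the norm has right derivative 0. Left continuity rules out the
  jumps that a zero right derivative alone would allow. The frequency comes from inserting sin
  (\<pi>x/L) into rho1 I1 y_tt = E1 I1 y_xx - G1 h1 y, which gives rho1 I1 \<omega>^2 = E1 I1
  (\<pi>/L)^2 + G1 h1. Evaluating the operator on this state is the other obstacle.
  \<open>wderiv\<close> is a choice that is determined only up to null sets, so uniqueness of weak
  derivatives is needed, hence the fundamental lemma of the calculus of variations.
  \<open>sobolev0\<close> is a closure of test functions, so the sine has to be approximated by
  explicit smooth functions of compact support.\<close>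

definition flat_exp :: "nat \<Rightarrow> real \<Rightarrow> real" where
  "flat_exp j y = (if 0 < y then exp (- 1 / y) / y ^ j else 0)"

text \<open>With x = 1/y the right limit becomes that of x^j e^(-x) at infinity.\<close>

lemma flat_exp_tendsto_0: "(flat_exp j \<longlongrightarrow> 0) (at 0)"
proof -
  have "((\<lambda>y. exp (- 1 / y) / y ^ j) \<longlongrightarrow> 0) (at_right (0::real))"
  proof -
    have "((\<lambda>x::real. x ^ j / exp x) \<longlongrightarrow> 0) at_top"
      by (rule tendsto_power_div_exp_0)
    then have "((\<lambda>y::real. (inverse y) ^ j / exp (inverse y)) \<longlongrightarrow> 0) (at_right 0)"
      by (rule filterlim_compose[OF _ filterlim_inverse_at_top_right])
    then show ?thesis
      by (simp add: exp_minus field_simps)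
  qed
  then have "(flat_exp j \<longlongrightarrow> 0) (at_right 0)"
    by (rule Lim_transform_eventually)
      (auto simp: flat_exp_def eventually_at_right_less intro: eventually_at_rightI[of 0 1])
  moreover have "(flat_exp j \<longlongrightarrow> 0) (at_left 0)"
    by (rule tendsto_eventually) (auto simp: flat_exp_def intro: eventually_at_leftI[of "-1"])
  ultimately show ?thesis
    by (simp add: filterlim_split_at)
qed

text \<open>The derivative stays in the family, with higher indices. This is why the power in the
  denominator is a parameter.\<close>

lemma flat_exp_has_derivative:
  "(flat_exp j has_real_derivative (flat_exp (j + 2) y - j * flat_exp (j + 1) y)) (at y)"
proof -
  consider "0 < y" | "y < 0" | "y = 0" by linarith
  then show ?thesis
  proof cases
    case 1
    have "((\<lambda>y. exp (- 1 / y) / y ^ j) has_real_derivative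
        (exp (- 1 / y) / y ^ (j + 2) - j * (exp (- 1 / y) / y ^ (j + 1)))) (at y)"
    proof (rule DERIV_cong)
      show "((\<lambda>y. exp (- 1 / y) / y ^ j) has_real_derivative
          (exp (- 1 / y) / y\<^sup>2 * y ^ j - exp (- 1 / y) * (j * y ^ (j - 1))) / (y ^ j * y ^ j)) (at y)"
        using 1
        by (intro DERIV_divide DERIV_pow[THEN DERIV_cong])
          (auto intro!: derivative_eq_intros simp: field_simps power2_eq_square)
    qed (use 1 in \<open>cases j; simp add: field_simps power2_eq_square\<close>)
    then have "(flat_exp j has_real_derivative
        (exp (- 1 / y) / y ^ (j + 2) - j * (exp (- 1 / y) / y ^ (j + 1)))) (at y)"
      by (rule has_field_derivative_transform_within_open[of _ _ _ "{0<..}"])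
        (use 1 in \<open>auto simp: flat_exp_def\<close>)
    then show ?thesis
      using 1 by (simp add: flat_exp_def)
  next
    case 2
    have "((\<lambda>y. 0) has_real_derivative 0) (at y)"
      by simp
    then have "(flat_exp j has_real_derivative 0) (at y)"
      by (rule has_field_derivative_transform_within_open[of _ _ _ "{..<0}"])
        (use 2 in \<open>auto simp: flat_exp_def\<close>)
    then show ?thesis
      using 2 by (simp add: flat_exp_def)
  next
    case 3
    \<comment> \<open>The difference quotient at 0 is the next member of the family, whose limit is
      known.\<close>
    have "(\<lambda>h. (flat_exp j (0 + h) - flat_exp j 0) / h) = flat_exp (Suc j)"
      by (auto simp: flat_exp_def)
    then have "(flat_exp j has_real_derivative 0) (at 0)"
      using flat_exp_tendsto_0[of "Suc j"] by (simp add: DERIV_def)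
    then show ?thesis
      using 3 by (simp add: flat_exp_def)
  qed
qed

text \<open>A syntactic class that contains the derivative of each of its members. Infinite
  differentiability then follows by iterating one closure step, without formulas for higher
  derivatives.\<close>

inductive smooth_expr :: "(real \<Rightarrow> complex) \<Rightarrow> bool" where
  const: "smooth_expr (\<lambda>x. c)"
| sine: "smooth_expr (\<lambda>x. of_real (sin (k * x)))"
| cosine: "smooth_expr (\<lambda>x. of_real (cos (k * x)))"
| flat: "smooth_expr (\<lambda>x. of_real (flat_exp j (a * x + b)))"
| plus: "smooth_expr f \<Longrightarrow> smooth_expr g \<Longrightarrow> smooth_expr (\<lambda>x. f x + g x)"
| times: "smooth_expr f \<Longrightarrow> smooth_expr g \<Longrightarrow> smooth_expr (\<lambda>x. f x * g x)"

lemma flat_exp_affine_has_derivative: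
  "((\<lambda>x. flat_exp j (a * x + b)) has_real_derivative
      (flat_exp (j + 2) (a * x + b) - j * flat_exp (j + 1) (a * x + b)) * a) (at x)"
  by (rule DERIV_chain'[where f = "\<lambda>x. a * x + b", OF _ flat_exp_has_derivative])
    (auto intro!: derivative_eq_intros)

lemma smooth_expr_derivative:
  assumes "smooth_expr f"
  shows "\<exists>f'. smooth_expr f' \<and> (\<forall>x. (f has_vector_derivative f' x) (at x))"
  using assms
proof induction
  case (const c)
  then show ?case
    by (intro exI[of _ "\<lambda>x. 0"]) (auto intro: smooth_expr.const)
next
  case (sine k)
  show ?case
  proof (intro exI conjI allI)
    show "smooth_expr (\<lambda>x. of_real k * of_real (cos (k * x)))"
      by (intro smooth_expr.intros)
    show "((\<lambda>x. complex_of_real (sin (k * x))) has_vector_derivative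
        of_real k * of_real (cos (k * x))) (at x)" for x
      unfolding of_real_mult[symmetric]
      by (rule has_vector_derivative_of_real) (auto intro!: derivative_eq_intros)
  qed
next
  case (cosine k)
  show ?case
  proof (intro exI conjI allI)
    show "smooth_expr (\<lambda>x. of_real (- k) * of_real (sin (k * x)))"
      by (intro smooth_expr.intros)
    show "((\<lambda>x. complex_of_real (cos (k * x))) has_vector_derivative
        of_real (- k) * of_real (sin (k * x))) (at x)" for x
      unfolding of_real_mult[symmetric]
      by (rule has_vector_derivative_of_real) (auto intro!: derivative_eq_intros)
  qed
next
  case (flat j a b)
  show ?case
  proof (intro exI conjI allI)
    show "smooth_expr (\<lambda>x. (of_real (flat_exp (j + 2) (a * x + b))
        + of_real (- real j) * of_real (flat_exp (j + 1) (a * x + b))) * of_real a)"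
      by (intro smooth_expr.intros)
    show "((\<lambda>x. complex_of_real (flat_exp j (a * x + b))) has_vector_derivative
        (of_real (flat_exp (j + 2) (a * x + b))
        + of_real (- real j) * of_real (flat_exp (j + 1) (a * x + b))) * of_real a) (at x)" for x
      unfolding of_real_mult[symmetric] of_real_add[symmetric]
      using flat_exp_affine_has_derivative[of j a b x]
      by (intro has_vector_derivative_of_real) simp
  qed
next
  case (plus f g)
  then obtain f' g' where
    "smooth_expr f'" "\<And>x. (f has_vector_derivative f' x) (at x)"
    "smooth_expr g'" "\<And>x. (g has_vector_derivative g' x) (at x)"
    by blast
  then show ?case
    by (intro exI[of _ "\<lambda>x. f' x + g' x"])
      (auto intro: smooth_expr.intros has_vector_derivative_add)
next
  case (times f g)
  then obtain f' g' where
    "smooth_expr f'" "\<And>x. (f has_vector_derivative f' x) (at x)"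
    "smooth_expr g'" "\<And>x. (g has_vector_derivative g' x) (at x)"
    by blast
  with times.hyps show ?case
    by (intro exI[of _ "\<lambda>x. f x * g' x + f' x * g x"])
      (auto intro: smooth_expr.intros has_vector_derivative_mult)
qed

lemma vderivI: "(\<And>x. (f has_vector_derivative f' x) (at x)) \<Longrightarrow> vderiv f = f'"
  unfolding vderiv_def by (auto intro: vector_derivative_at)

lemma smooth_expr_vderiv: "smooth_expr f \<Longrightarrow> smooth_expr (vderiv f)"
  using smooth_expr_derivative vderivI by metis

lemma smooth_expr_iterate: "smooth_expr f \<Longrightarrow> smooth_expr ((vderiv ^^ n) f)"
  by (induction n) (auto intro: smooth_expr_vderiv)

lemma smooth_expr_differentiable: "smooth_expr f \<Longrightarrow> f differentiable (at x)"
  using smooth_expr_derivative[of f] by (auto simp: has_vector_derivative_def differentiable_def)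

lemma smooth_expr_test_fun:
  "smooth_expr f \<Longrightarrow> closure {x. f x \<noteq> 0} \<subseteq> {0<..<L} \<Longrightarrow> f \<in> test_fun L"
  by (simp add: test_fun_def smooth_expr_iterate smooth_expr_differentiable)

section \<open>Test functions as a vector space\<close>

lemma test_fun_differentiable: "\<phi> \<in> test_fun L \<Longrightarrow> (vderiv ^^ n) \<phi> differentiable (at x)"
  by (simp add: test_fun_def)

lemma test_fun_has_vderiv: "\<phi> \<in> test_fun L \<Longrightarrow> (\<phi> has_vector_derivative vderiv \<phi> x) (at x)"
  using test_fun_differentiable[of \<phi> L 0 x] by (simp add: vderiv_def vector_derivative_works)

lemma test_fun_continuous:
  assumes "\<phi> \<in> test_fun L"
  shows "continuous_on S \<phi>" "continuous_on S (vderiv \<phi>)"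
  using test_fun_differentiable[OF assms, of 0] test_fun_differentiable[OF assms, of 1]
  by (auto simp: continuous_on_eq_continuous_within intro!: differentiable_imp_continuous_within
      intro: differentiable_at_withinI)

lemma test_fun_eq_0: "\<phi> \<in> test_fun L \<Longrightarrow> x \<notin> {0<..<L} \<Longrightarrow> \<phi> x = 0"
  using closure_subset[of "{x. \<phi> x \<noteq> 0}"] by (auto simp: test_fun_def)

lemma vderiv_iterate_lincomb:
  assumes "\<And>m x. m < n \<Longrightarrow> (vderiv ^^ m) f differentiable (at x)"
    and "\<And>m x. m < n \<Longrightarrow> (vderiv ^^ m) g differentiable (at x)"
  shows "(vderiv ^^ n) (\<lambda>x. \<alpha> * f x + \<beta> * g x)
    = (\<lambda>x. \<alpha> * (vderiv ^^ n) f x + \<beta> * (vderiv ^^ n) g x)"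
  using assms
proof (induction n)
  case (Suc n)
  have "((vderiv ^^ n) f has_vector_derivative (vderiv ^^ Suc n) f x) (at x)"
    "((vderiv ^^ n) g has_vector_derivative (vderiv ^^ Suc n) g x) (at x)" for x
    using Suc.prems[of n x] by (simp_all add: vector_derivative_works vderiv_def[of "(vderiv ^^ n) _"])
  then have "vderiv (\<lambda>x. \<alpha> * (vderiv ^^ n) f x + \<beta> * (vderiv ^^ n) g x)
      = (\<lambda>x. \<alpha> * (vderiv ^^ Suc n) f x + \<beta> * (vderiv ^^ Suc n) g x)"
    by (intro vderivI) (auto intro!: derivative_intros)
  with Suc show ?case
    by simp
qed simp

lemma test_fun_lincomb:
  assumes "f \<in> test_fun L" "g \<in> test_fun L"
  shows "(\<lambda>x. \<alpha> * f x + \<beta> * g x) \<in> test_fun L"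
proof -
  have "(vderiv ^^ n) (\<lambda>x. \<alpha> * f x + \<beta> * g x) differentiable (at x)" for n x
    using assms
    by (subst vderiv_iterate_lincomb) (auto simp: test_fun_def intro!: derivative_intros)
  moreover have "closure {x. \<alpha> * f x + \<beta> * g x \<noteq> 0}
      \<subseteq> closure ({x. f x \<noteq> 0} \<union> {x. g x \<noteq> 0})"
    by (rule closure_mono) auto
  then have "closure {x. \<alpha> * f x + \<beta> * g x \<noteq> 0} \<subseteq> {0<..<L}"
    using assms by (auto simp: test_fun_def)
  ultimately show ?thesis
    by (simp add: test_fun_def)
qed

lemma zero_test_fun: "(\<lambda>x. 0) \<in> test_fun L"
  by (rule smooth_expr_test_fun) (auto intro: smooth_expr.const)

text \<open>For n > 0 the two factors vanish to the left of a + 1/n and to the right of b - 1/n, and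
  at each point of (a,b) they tend to 1. The arguments have the affine form that the rule
  \<open>flat\<close> of \<open>smooth_expr\<close> expects.\<close>

definition cutoff :: "real \<Rightarrow> real \<Rightarrow> nat \<Rightarrow> real \<Rightarrow> complex" where
  "cutoff a b n x =
    of_real (flat_exp 0 (real n * x + (- real n * a - 1)))
    * of_real (flat_exp 0 ((- real n) * x + (real n * b - 1)))"

lemma flat_exp_0_bounds: "0 \<le> flat_exp 0 y" "flat_exp 0 y \<le> 1"
  by (auto simp: flat_exp_def)

lemma smooth_expr_cutoff: "smooth_expr (cutoff a b n)"
  unfolding cutoff_def by (intro smooth_expr.intros)

lemma norm_cutoff_le: "cmod (cutoff a b n x) \<le> 1"
  by (auto simp: cutoff_def norm_mult flat_exp_0_bounds intro!: mult_le_one)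

lemma cutoff_support:
  assumes "0 \<le> a" "b \<le> L"
  shows "closure {x. cutoff a b n x \<noteq> 0} \<subseteq> {0<..<L}"
proof (cases "n = 0")
  \<comment> \<open>For n = 0 both arguments of \<open>flat_exp 0\<close> equal -1, so the cutoff is
    0 everywhere.\<close>
  case True
  then have "{x. cutoff a b n x \<noteq> 0} = {}"
    by (auto simp: cutoff_def flat_exp_def)
  then show ?thesis
    by (metis closure_empty empty_subsetI)
next
  case False
  have "{x. cutoff a b n x \<noteq> 0} \<subseteq> {a + 1 / n..b - 1 / n}"
    using False by (auto simp: cutoff_def flat_exp_def field_simps split: if_splits)
  then have "closure {x. cutoff a b n x \<noteq> 0} \<subseteq> {a + 1 / n..b - 1 / n}"
    by (rule closure_minimal) simp
  also have "\<dots> \<subseteq> {0<..<L}"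
  proof
    fix x assume "x \<in> {a + 1 / n..b - 1 / n}"
    moreover have "0 < 1 / real n"
      using False by simp
    ultimately show "x \<in> {0<..<L}"
      unfolding atLeastAtMost_iff greaterThanLessThan_iff using assms by linarith
  qed
  finally show ?thesis .
qed

lemma cutoff_mult_test_fun:
  assumes "0 \<le> a" "b \<le> L" "smooth_expr f"
  shows "(\<lambda>x. f x * cutoff a b n x) \<in> test_fun L"
proof (rule smooth_expr_test_fun)
  show "smooth_expr (\<lambda>x. f x * cutoff a b n x)"
    by (intro smooth_expr.times assms smooth_expr_cutoff)
  have "closure {x. f x * cutoff a b n x \<noteq> 0} \<subseteq> closure {x. cutoff a b n x \<noteq> 0}"
    by (rule closure_mono) auto
  then show "closure {x. f x * cutoff a b n x \<noteq> 0} \<subseteq> {0<..<L}"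
    using cutoff_support[OF assms(1,2)] by blast
qed

lemma flat_exp_affine_tendsto:
  assumes "0 < c"
  shows "(\<lambda>n. flat_exp 0 (real n * c - 1)) \<longlonglongrightarrow> 1"
proof -
  have lim: "filterlim (\<lambda>n. real n * c - 1) at_top sequentially"
    using filterlim_tendsto_add_at_top[OF tendsto_const[of "- 1"]
        filterlim_at_top_mult_tendsto_pos[OF tendsto_const assms filterlim_real_sequentially]]
    by simp
  have "((\<lambda>y::real. exp (- 1 / y)) \<longlongrightarrow> exp 0) at_top"
    by (intro tendsto_exp tendsto_divide_0[OF tendsto_const]
        filterlim_at_top_imp_at_infinity filterlim_ident)
  then have "((\<lambda>y::real. exp (- 1 / y)) \<longlongrightarrow> 1) at_top"
    by simp
  then have "(\<lambda>n. exp (- 1 / (real n * c - 1))) \<longlonglongrightarrow> 1"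
    using lim by (rule filterlim_compose)
  then show ?thesis
  proof (rule Lim_transform_eventually)
    have "\<forall>\<^sub>F n in sequentially. 0 < real n * c - 1"
      using lim unfolding filterlim_at_top_dense by blast
    then show "\<forall>\<^sub>F n in sequentially.
        exp (- 1 / (real n * c - 1)) = flat_exp 0 (real n * c - 1)"
      by eventually_elim (simp add: flat_exp_def)
  qed
qed

lemma cutoff_tendsto_indicator:
  "(\<lambda>n. cutoff a b n x) \<longlonglongrightarrow> indicator {a<..<b} x"
proof (cases "x \<in> {a<..<b}")
  case True
  have eq: "cutoff a b n x
      = of_real (flat_exp 0 (real n * (x - a) - 1)) * of_real (flat_exp 0 (real n * (b - x) - 1))"
    for n by (simp add: cutoff_def algebra_simps)
  have "(\<lambda>n. cutoff a b n x) \<longlonglongrightarrow> of_real 1 * of_real 1"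
    unfolding eq using True by (intro tendsto_mult tendsto_of_real flat_exp_affine_tendsto) auto
  with True show ?thesis
    by simp
next
  case False
  have "cutoff a b n x = 0" for n
  proof -
    have "x \<le> a \<or> b \<le> x"
      using False by auto
    then have "n * x + (- real n * a - 1) \<le> 0 \<or> (- real n) * x + (n * b - 1) \<le> 0"
      using mult_left_mono[of x a "real n"] mult_left_mono[of b x "real n"] by fastforce
    then show ?thesis
      by (auto simp: cutoff_def flat_exp_def)
  qed
  with False show ?thesis
    by simp
qed


section \<open>Square-integrable functions\<close>

lemma finite_measure_intv: "finite_measure (intv L)"
  by (intro finite_measureI)
    (cases "0 \<le> L"; simp add: emeasure_restrict_space greaterThanLessThan_empty)

lemma continuous_measurable_intv:
  "continuous_on UNIV f \<Longrightarrow> f \<in> borel_measurable (intv L)"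
  for f :: "real \<Rightarrow> complex"
  by (intro measurable_restrict_space1 measurable_completion)
    (simp add: borel_measurable_continuous_onI)

lemma continuous_bounded_intv:
  fixes f :: "real \<Rightarrow> complex"
  assumes "continuous_on UNIV f"
  obtains B where "\<And>x. x \<in> {0<..<L} \<Longrightarrow> cmod (f x) \<le> B"
proof -
  have "compact (f ` {0..L})"
    using assms by (intro compact_continuous_image) (auto intro: continuous_on_subset)
  then obtain B where "\<forall>y \<in> f ` {0..L}. norm y \<le> B"
    using compact_imp_bounded bounded_iff by blast
  then show ?thesis
    by (intro that[of B]) auto
qed

lemma continuous_L2:
  assumes "continuous_on UNIV f"
  shows "f \<in> L2 L"
proof -
  interpret finite_measure "intv L" by (rule finite_measure_intv)
  obtain B where B: "\<And>x. x \<in> {0<..<L} \<Longrightarrow> cmod (f x) \<le> B"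
    using continuous_bounded_intv[OF assms, of L] by blast
  have [measurable]: "f \<in> borel_measurable (intv L)"
    by (rule continuous_measurable_intv[OF assms])
  have "integrable (intv L) (\<lambda>x. (cmod (f x))\<^sup>2)"
    by (rule integrable_const_bound[of _ "B\<^sup>2"]) (auto intro!: AE_I2 power_mono B)
  then show ?thesis
    by (simp add: L2_def)
qed

lemma L2_measurable: "f \<in> L2 L \<Longrightarrow> f \<in> borel_measurable (intv L)"
  by (simp add: L2_def)

text \<open>On an interval of finite length |f| is dominated by the integrable function 1 +
  |f|^2.\<close>

lemma L2_integrable:
  assumes "f \<in> L2 L"
  shows "integrable (intv L) f"
proof -
  interpret finite_measure "intv L" by (rule finite_measure_intv)
  have [measurable]: "f \<in> borel_measurable (intv L)"
    using assms by (rule L2_measurable)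
  have "integrable (intv L) (\<lambda>x. 1 + (cmod (f x))\<^sup>2)"
    using assms by (auto simp: L2_def)
  then show ?thesis
  proof (rule Bochner_Integration.integrable_bound)
    have "cmod (f x) \<le> norm (1 + (cmod (f x))\<^sup>2)" for x
      using sum_squares_bound[of "cmod (f x)" 1] norm_ge_zero[of "f x"]
      unfolding real_norm_def by (smt (verit) mult_1 one_power2)
    then show "AE x in intv L. norm (f x) \<le> norm (1 + (cmod (f x))\<^sup>2)"
      by simp
  qed simp
qed

lemma L2_integrable_mult:
  assumes "f \<in> L2 L" "continuous_on UNIV \<phi>"
  shows "integrable (intv L) (\<lambda>x. f x * \<phi> x)"
proof -
  obtain B where B: "\<And>x. x \<in> {0<..<L} \<Longrightarrow> cmod (\<phi> x) \<le> B"
    using continuous_bounded_intv[OF assms(2), of L] by blast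
  have [measurable]: "f \<in> borel_measurable (intv L)" "\<phi> \<in> borel_measurable (intv L)"
    using assms L2_measurable continuous_measurable_intv by auto
  have "integrable (intv L) (\<lambda>x. of_real B * f x)"
    using L2_integrable[OF assms(1)] by simp
  then show ?thesis
  proof (rule Bochner_Integration.integrable_bound)
    have "cmod (f x * \<phi> x) \<le> cmod (of_real B * f x)" if "x \<in> {0<..<L}" for x
      using mult_right_mono[OF order_trans[OF B[OF that] abs_ge_self], of "cmod (f x)"]
      by (simp add: norm_mult mult.commute)
    then show "AE x in intv L. norm (f x * \<phi> x) \<le> norm (of_real B * f x)"
      by (intro AE_I2) auto
  qed simp
qed

text \<open>Triangle inequality followed by Young's inequality. The free parameter r survives
  integration and summation over the energy terms; optimizing it at the very end recovers the
  triangle inequality for the energy norm, and r = 1 suffices where constants do not matter.\<close>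

lemma cmod_lincomb_sq_le:
  assumes "0 < r"
  shows "(cmod (\<alpha> * x + \<beta> * y))\<^sup>2
    \<le> (1 + r) * ((cmod \<alpha>)\<^sup>2 * (cmod x)\<^sup>2) + (1 + 1 / r) * ((cmod \<beta>)\<^sup>2 * (cmod y)\<^sup>2)"
proof -
  define s t where "s = cmod \<alpha> * cmod x" and "t = cmod \<beta> * cmod y"
  have "(cmod (\<alpha> * x + \<beta> * y))\<^sup>2 \<le> (s + t)\<^sup>2"
    unfolding s_def t_def norm_mult[symmetric] by (intro power_mono norm_triangle_ineq) simp
  also have "\<dots> \<le> (1 + r) * s\<^sup>2 + (1 + 1 / r) * t\<^sup>2"
  proof -
    have "0 \<le> (r * s - t)\<^sup>2 / r"
      using assms by simp
    also have "\<dots> = r * s\<^sup>2 + 1 / r * t\<^sup>2 - 2 * s * t"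
      using assms by (simp add: power2_eq_square field_simps)
    finally show ?thesis
      by (simp add: power2_eq_square algebra_simps)
  qed
  finally show ?thesis
    by (simp add: s_def t_def power_mult_distrib)
qed

lemma L2_sq_integrable: "f \<in> L2 L \<Longrightarrow> integrable (intv L) (\<lambda>x. (cmod (f x))\<^sup>2)"
  by (simp add: L2_def)

lemma L2_lincomb:
  assumes "f \<in> L2 L" "g \<in> L2 L"
  shows "(\<lambda>x. \<alpha> * f x + \<beta> * g x) \<in> L2 L"
proof -
  have [measurable]: "f \<in> borel_measurable (intv L)" "g \<in> borel_measurable (intv L)"
    using assms L2_measurable by auto
  have "integrable (intv L) (\<lambda>x. (1 + 1) * ((cmod \<alpha>)\<^sup>2 * (cmod (f x))\<^sup>2)
      + (1 + 1 / 1) * ((cmod \<beta>)\<^sup>2 * (cmod (g x))\<^sup>2))"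
    by (intro Bochner_Integration.integrable_add integrable_mult_right L2_sq_integrable assms)
  then have "integrable (intv L) (\<lambda>x. (cmod (\<alpha> * f x + \<beta> * g x))\<^sup>2)"
  proof (rule Bochner_Integration.integrable_bound)
    show "AE x in intv L. norm ((cmod (\<alpha> * f x + \<beta> * g x))\<^sup>2)
        \<le> norm ((1 + 1) * ((cmod \<alpha>)\<^sup>2 * (cmod (f x))\<^sup>2)
          + (1 + 1 / 1) * ((cmod \<beta>)\<^sup>2 * (cmod (g x))\<^sup>2))"
      using cmod_lincomb_sq_le[of 1] by (intro AE_I2) fastforce
  qed simp
  then show ?thesis
    by (simp add: L2_def)
qed

lemma L2_norm_sq: "(L2_norm L f)\<^sup>2 = (LINT x|intv L. (cmod (f x))\<^sup>2)"
  unfolding L2_norm_def by (rule real_sqrt_pow2) (rule integral_nonneg_AE, simp)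

lemma L2_norm_lincomb_sq_le:
  assumes "f \<in> L2 L" "g \<in> L2 L" "0 < r"
  shows "(L2_norm L (\<lambda>x. \<alpha> * f x + \<beta> * g x))\<^sup>2
    \<le> (1 + r) * ((cmod \<alpha>)\<^sup>2 * (L2_norm L f)\<^sup>2)
      + (1 + 1 / r) * ((cmod \<beta>)\<^sup>2 * (L2_norm L g)\<^sup>2)"
proof -
  have "(L2_norm L (\<lambda>x. \<alpha> * f x + \<beta> * g x))\<^sup>2
      \<le> (LINT x|intv L. (1 + r) * ((cmod \<alpha>)\<^sup>2 * (cmod (f x))\<^sup>2)
          + (1 + 1 / r) * ((cmod \<beta>)\<^sup>2 * (cmod (g x))\<^sup>2))"
    unfolding L2_norm_sq
    by (intro integral_mono cmod_lincomb_sq_le Bochner_Integration.integrable_add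
        integrable_mult_right L2_sq_integrable L2_lincomb assms)
  also have "\<dots> = (1 + r) * ((cmod \<alpha>)\<^sup>2 * (L2_norm L f)\<^sup>2)
      + (1 + 1 / r) * ((cmod \<beta>)\<^sup>2 * (L2_norm L g)\<^sup>2)"
    unfolding L2_norm_sq using L2_sq_integrable[OF assms(1)] L2_sq_integrable[OF assms(2)]
    by (subst Bochner_Integration.integral_add) auto
  finally show ?thesis .
qed

lemma L2_norm_cong_AE:
  assumes "f \<in> L2 L" "g \<in> L2 L" "AE x in intv L. f x = g x"
  shows "L2_norm L f = L2_norm L g"
proof -
  have [measurable]: "f \<in> borel_measurable (intv L)" "g \<in> borel_measurable (intv L)"
    using assms L2_measurable by auto
  show ?thesis
    unfolding L2_norm_def using assms(3)
    by (intro arg_cong[where f = sqrt] integral_cong_AE) auto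
qed

lemma sets_intv: "A \<in> sets (intv L) \<longleftrightarrow> A \<in> sets lebesgue \<and> A \<subseteq> {0<..<L}"
  by (subst sets_restrict_space_iff) auto

text \<open>The intervals \<open>(a,L)\<close> generate the Borel subsets of \<open>(0,L)\<close>, and their indicators are
  bounded pointwise limits of test functions.\<close>

lemma AE_zero_if_test_integrals_zero:
  assumes g: "g \<in> L2 L" and zero: "\<And>\<phi>. \<phi> \<in> test_fun L \<Longrightarrow> (LINT x|intv L. g x * \<phi> x) = 0"
  shows "AE x in intv L. g x = 0"
proof -
  interpret finite_measure "intv L" by (rule finite_measure_intv)
  have int: "integrable (intv L) g"
    by (rule L2_integrable[OF g])
  have [measurable]: "g \<in> borel_measurable (intv L)"
    by (rule L2_measurable[OF g])
  have borel_intv: "A \<inter> {0<..<L} \<in> sets (intv L)" if "A \<in> sets borel" for A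
    using that by (auto simp: sets_intv)
  have ray: "(LINT x|intv L. indicator {a<..} x *\<^sub>R g x) = 0" for a
  proof -
    \<comment> \<open>Moving the left end point into the domain keeps the cutoffs test functions; on
      (0,L) the rays from a and from c have the same indicator.\<close>
    define c where "c = max 0 a"
    have lim: "(\<lambda>n. LINT x|intv L. g x * cutoff c L n x)
        \<longlonglongrightarrow> (LINT x|intv L. g x * indicator {c<..<L} x)"
    proof (rule integral_dominated_convergence)
      show "integrable (intv L) (\<lambda>x. cmod (g x))"
        using int by simp
      have "(\<lambda>x. cutoff c L n x) \<in> borel_measurable (intv L)" for n
        by (intro continuous_measurable_intv)
          (auto simp: continuous_on_eq_continuous_within
            intro!: differentiable_imp_continuous_within smooth_expr_differentiable
              smooth_expr_cutoff)
      then show "(\<lambda>x. g x * cutoff c L n x) \<in> borel_measurable (intv L)" for n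
        by simp
      have "{c<..<L} \<in> sets (intv L)"
        by (auto simp: sets_intv c_def)
      then show "(\<lambda>x. g x * indicator {c<..<L} x) \<in> borel_measurable (intv L)"
        by simp
      show "AE x in intv L. (\<lambda>n. g x * cutoff c L n x) \<longlonglongrightarrow> g x * indicator {c<..<L} x"
        by (intro AE_I2 tendsto_mult tendsto_const cutoff_tendsto_indicator)
      show "AE x in intv L. norm (g x * cutoff c L n x) \<le> cmod (g x)" for n
        using norm_cutoff_le by (intro AE_I2) (simp add: norm_mult mult_left_le)
    qed
    have "(LINT x|intv L. g x * cutoff c L n x) = 0" for n
      by (intro zero smooth_expr_test_fun smooth_expr_cutoff cutoff_support) (auto simp: c_def)
    with lim have "(LINT x|intv L. g x * indicator {c<..<L} x) = 0"
      by (simp add: LIMSEQ_const_iff)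
    moreover have "(LINT x|intv L. g x * indicator {c<..<L} x)
        = (LINT x|intv L. indicator {a<..} x *\<^sub>R g x)"
      by (intro Bochner_Integration.integral_cong) (auto simp: indicator_def c_def)
    ultimately show ?thesis
      by simp
  qed
  \<comment> \<open>This total integral is what the complement case of the Dynkin induction
    subtracts from.\<close>
  have whole: "(LINT x|intv L. g x) = 0"
  proof -
    have "(LINT x|intv L. g x) = (LINT x|intv L. indicator {0<..} x *\<^sub>R g x)"
      by (intro Bochner_Integration.integral_cong) (auto simp: indicator_def)
    then show ?thesis
      by (simp add: ray)
  qed
  have int_ind: "integrable (intv L) (\<lambda>x. indicator A x *\<^sub>R g x)" if "A \<in> sets borel" for A
  proof -
    have "integrable (intv L) (\<lambda>x. indicator (A \<inter> {0<..<L}) x *\<^sub>R g x)"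
      by (intro integrable_mult_indicator int borel_intv that)
    then show ?thesis
      by (rule Bochner_Integration.integrable_cong[THEN iffD1, rotated -1])
        (auto simp: indicator_def)
  qed
  have borel: "(LINT x|intv L. indicator A x *\<^sub>R g x) = 0" if "A \<in> sets borel" for A
  proof -
    have sig: "sets borel = sigma_sets UNIV (range (\<lambda>a::real. {a<..}))"
      by (simp add: borel_Ioi)
    have "Int_stable (range (\<lambda>a::real. {a<..}))"
      by (auto simp: Int_stable_def lessThan_Int_lessThan)
    moreover have "range (\<lambda>a::real. {a<..}) \<subseteq> Pow UNIV"
      by simp
    moreover have "A \<in> sigma_sets UNIV (range (\<lambda>a::real. {a<..}))"
      using that sig by simp
    ultimately show ?thesis
    proof (induction rule: sigma_sets_induct_disjoint)
      case (basic A)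
      then show ?case by (auto simp: ray)
    next
      case empty
      then show ?case by simp
    next
      case (compl A)
      then have "A \<in> sets borel" using sig by simp
      have "(LINT x|intv L. indicator (UNIV - A) x *\<^sub>R g x)
          = (LINT x|intv L. g x - indicator A x *\<^sub>R g x)"
        by (intro Bochner_Integration.integral_cong) (auto simp: indicator_def)
      also have "\<dots> = 0"
        using compl int int_ind[OF \<open>A \<in> sets borel\<close>] whole by simp
      finally show ?case .
    next
      case (union A)
      then have A: "A i \<in> sets borel" for i using sig by auto
      have "(\<lambda>n. LINT x|intv L. (\<Sum>i<n. indicator (A i) x *\<^sub>R g x))
          \<longlonglongrightarrow> (LINT x|intv L. indicator (\<Union>i. A i) x *\<^sub>R g x)"
      proof (rule integral_dominated_convergence)
        show "integrable (intv L) (\<lambda>x. cmod (g x))"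
          using int by simp
        show "(\<lambda>x. \<Sum>i<n. indicator (A i) x *\<^sub>R g x) \<in> borel_measurable (intv L)" for n
          using int_ind[OF A] by (intro borel_measurable_sum) auto
        show "(\<lambda>x. indicator (\<Union>i. A i) x *\<^sub>R g x) \<in> borel_measurable (intv L)"
          using int_ind[of "\<Union>i. A i"] A by auto
        have sum: "(\<Sum>i<n. indicator (A i) x *\<^sub>R g x) = indicator (\<Union>i<n. A i) x *\<^sub>R g x"
          for n x
        proof -
          have "(\<Sum>i<n. indicator (A i) x :: real) = indicator (\<Union>i<n. A i) x"
            using union(1) by (subst indicator_UN_disjoint)
              (auto simp: disjoint_family_on_def)
          then show ?thesis
            by (metis scaleR_sum_left)
        qed
        show "AE x in intv L. (\<lambda>n. \<Sum>i<n. indicator (A i) x *\<^sub>R g x)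
            \<longlonglongrightarrow> indicator (\<Union>i. A i) x *\<^sub>R g x"
          unfolding sum by (intro AE_I2 tendsto_scaleR LIMSEQ_indicator_UN tendsto_const)
        show "AE x in intv L. norm (\<Sum>i<n. indicator (A i) x *\<^sub>R g x) \<le> cmod (g x)" for n
          unfolding sum by (intro AE_I2) (simp add: indicator_def)
      qed
      moreover have "(LINT x|intv L. (\<Sum>i<n. indicator (A i) x *\<^sub>R g x)) = 0" for n
        using union(3) int_ind[OF A] by (subst Bochner_Integration.integral_sum) simp_all
      ultimately show ?case
        by (simp add: LIMSEQ_const_iff)
    qed
  qed
  show ?thesis
  proof (rule density_zero[OF int])
    fix A assume "A \<in> sets (intv L)"
    then have A: "A \<in> sets lebesgue" "A \<subseteq> {0<..<L}"
      by (auto simp: sets_intv)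
    \<comment> \<open>A Lebesgue set differs from a Borel set by a null set, so vanishing on Borel
      sets is enough.\<close>
    then obtain C T where CT: "fsigma C" "T \<in> null_sets lebesgue" "C \<union> T = A"
      by (auto elim: lebesgue_set_almost_fsigma)
    have "C \<in> sets borel"
      using CT(1) by (auto elim!: fsigma.cases)
    have "AE x in lebesgue. x \<notin> T"
      by (rule AE_not_in[OF CT(2)])
    then have "AE x in intv L. x \<notin> T"
      by (subst AE_restrict_space_iff) auto
    then have "set_lebesgue_integral (intv L) A g = (LINT x|intv L. indicator C x *\<^sub>R g x)"
      unfolding set_lebesgue_integral_def
      using int_ind[OF \<open>C \<in> sets borel\<close>] \<open>A \<in> sets (intv L)\<close> CT(3)
      by (intro integral_cong_AE) (auto simp: indicator_def)
    then show "set_lebesgue_integral (intv L) A g = 0"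
      using borel[OF \<open>C \<in> sets borel\<close>] by simp
  qed
qed


section \<open>Weak derivatives\<close>

text \<open>The difference of the two candidates is orthogonal to all test functions.\<close>

lemma weak_deriv_unique:
  assumes "g \<in> L2 L" "h \<in> L2 L" "is_weak_deriv L f g" "is_weak_deriv L f h"
  shows "AE x in intv L. g x = h x"
proof -
  have "AE x in intv L. 1 * g x + (- 1) * h x = 0"
  proof (rule AE_zero_if_test_integrals_zero)
    show "(\<lambda>x. 1 * g x + (- 1) * h x) \<in> L2 L"
      by (rule L2_lincomb[OF assms(1,2)])
    fix \<phi> assume \<phi>: "\<phi> \<in> test_fun L"
    have "(LINT x|intv L. (1 * g x + (- 1) * h x) * \<phi> x)
        = (LINT x|intv L. g x * \<phi> x) - (LINT x|intv L. h x * \<phi> x)"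
      using L2_integrable_mult[OF assms(1) test_fun_continuous(1)[OF \<phi>]]
        L2_integrable_mult[OF assms(2) test_fun_continuous(1)[OF \<phi>]]
      by (subst Bochner_Integration.integral_diff[symmetric]) (auto simp: algebra_simps)
    also have "\<dots> = 0"
      using assms(3,4) \<phi> unfolding is_weak_deriv_def by (metis add.inverse_inverse diff_self)
    finally show "(LINT x|intv L. (1 * g x + (- 1) * h x) * \<phi> x) = 0" .
  qed
  then show ?thesis
    by eventually_elim simp
qed

lemma is_weak_deriv_lincomb:
  assumes L2: "f \<in> L2 L" "g \<in> L2 L" "f' \<in> L2 L" "g' \<in> L2 L"
    and "is_weak_deriv L f f'" "is_weak_deriv L g g'"
  shows "is_weak_deriv L (\<lambda>x. \<alpha> * f x + \<beta> * g x) (\<lambda>x. \<alpha> * f' x + \<beta> * g' x)"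
  unfolding is_weak_deriv_def
proof
  fix \<phi> assume \<phi>: "\<phi> \<in> test_fun L"
  have lin: "(LINT x|intv L. (\<alpha> * u x + \<beta> * v x) * \<psi> x)
      = \<alpha> * (LINT x|intv L. u x * \<psi> x) + \<beta> * (LINT x|intv L. v x * \<psi> x)"
    if "u \<in> L2 L" "v \<in> L2 L" "continuous_on UNIV \<psi>" for u v \<psi>
    using L2_integrable_mult[OF that(1,3)] L2_integrable_mult[OF that(2,3)]
    by (subst integral_mult_right_zero[symmetric])+
      (subst Bochner_Integration.integral_add[symmetric], auto simp: algebra_simps)
  show "(LINT x|intv L. (\<alpha> * f x + \<beta> * g x) * vderiv \<phi> x)
      = - (LINT x|intv L. (\<alpha> * f' x + \<beta> * g' x) * \<phi> x)"
    using assms(5,6) \<phi>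
    by (simp add: lin L2 test_fun_continuous[OF \<phi>] is_weak_deriv_def)
qed

lemma is_weak_deriv_cong_AE:
  assumes "is_weak_deriv L f f'" "f \<in> L2 L" "g \<in> L2 L" "f' \<in> L2 L" "g' \<in> L2 L"
    and "AE x in intv L. f x = g x" "AE x in intv L. f' x = g' x"
  shows "is_weak_deriv L g g'"
  unfolding is_weak_deriv_def
proof
  fix \<phi> assume \<phi>: "\<phi> \<in> test_fun L"
  have eq: "(LINT x|intv L. u x * \<psi> x) = (LINT x|intv L. v x * \<psi> x)"
    if "u \<in> L2 L" "v \<in> L2 L" "AE x in intv L. u x = v x" "continuous_on UNIV \<psi>" for u v \<psi>
  proof (rule integral_cong_AE)
    show "AE x in intv L. u x * \<psi> x = v x * \<psi> x"
      using that(3) by eventually_elim simp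
  qed (use that L2_integrable_mult in auto)
  show "(LINT x|intv L. g x * vderiv \<phi> x) = - (LINT x|intv L. g' x * \<phi> x)"
    using assms(1) \<phi>
    by (simp add: eq[OF assms(2,3,6) test_fun_continuous(2)[OF \<phi>], symmetric]
        eq[OF assms(4,5,7) test_fun_continuous(1)[OF \<phi>], symmetric] is_weak_deriv_def)
qed

text \<open>One witness g makes the choice behind \<open>wderiv\<close> meaningful, and by
  uniqueness the choice agrees with g almost everywhere. All concrete values of
  \<open>wderiv\<close> are computed through the third part.\<close>

lemma wderiv_props:
  assumes "g \<in> L2 L" "is_weak_deriv L f g"
  shows "wderiv L f \<in> L2 L" "is_weak_deriv L f (wderiv L f)"
    "AE x in intv L. wderiv L f x = g x"
proof -
  show *: "wderiv L f \<in> L2 L" "is_weak_deriv L f (wderiv L f)"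
    using someI[of "\<lambda>g. g \<in> L2 L \<and> is_weak_deriv L f g" g] assms
    by (auto simp: wderiv_def)
  show "AE x in intv L. wderiv L f x = g x"
    by (rule weak_deriv_unique[OF *(1) assms(1) *(2) assms(2)])
qed

section \<open>Sobolev spaces and the linearity of weak derivatives\<close>

lemma sobolev_subset_L2: "f \<in> sobolev L k \<Longrightarrow> f \<in> L2 L"
  by (cases k) auto

text \<open>The chosen weak derivative matches a given one only almost everywhere, so membership
  must be transported along such equalities.\<close>

lemma sobolev_cong_AE:
  assumes "f \<in> sobolev L k" "g \<in> L2 L" "AE x in intv L. f x = g x"
  shows "g \<in> sobolev L k"
proof (cases k)
  case (Suc m)
  with assms(1) obtain f' where f': "f' \<in> sobolev L m" "is_weak_deriv L f f'"
    by auto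
  have "is_weak_deriv L g f'"
    using assms Suc f'(1)
    by (intro is_weak_deriv_cong_AE[OF f'(2)]) (auto intro: sobolev_subset_L2)
  with f' Suc assms(2) show ?thesis
    by auto
qed (use assms in simp)

lemma wderiv_sobolev:
  assumes "f \<in> sobolev L (Suc k)"
  shows "wderiv L f \<in> sobolev L k" "wderiv L f \<in> L2 L" "is_weak_deriv L f (wderiv L f)"
proof -
  obtain g where g: "g \<in> sobolev L k" "is_weak_deriv L f g"
    using assms by auto
  note props = wderiv_props[OF sobolev_subset_L2[OF g(1)] g(2)]
  show "wderiv L f \<in> L2 L" "is_weak_deriv L f (wderiv L f)"
    by (fact props)+
  show "wderiv L f \<in> sobolev L k"
    by (rule sobolev_cong_AE[OF g(1) props(1)]) (use props(3) in eventually_elim, simp)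
qed

lemma sobolev_iterate:
  "f \<in> sobolev L k \<Longrightarrow> j \<le> k \<Longrightarrow> (wderiv L ^^ j) f \<in> sobolev L (k - j)"
proof (induction j)
  case (Suc j)
  then have "(wderiv L ^^ j) f \<in> sobolev L (Suc (k - Suc j))"
    by (simp add: Suc_diff_Suc)
  then show ?case
    by (simp add: wderiv_sobolev(1))
qed simp

lemma sobolev_lincomb:
  assumes "f \<in> sobolev L k" "g \<in> sobolev L k"
  shows "(\<lambda>x. \<alpha> * f x + \<beta> * g x) \<in> sobolev L k"
  using assms
proof (induction k arbitrary: f g)
  case 0
  then show ?case by (simp add: L2_lincomb)
next
  case (Suc k)
  note f = wderiv_sobolev[OF Suc.prems(1)] and g = wderiv_sobolev[OF Suc.prems(2)]
  have "f \<in> L2 L" "g \<in> L2 L"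
    using Suc.prems by (auto intro: sobolev_subset_L2)
  with f g have "is_weak_deriv L (\<lambda>x. \<alpha> * f x + \<beta> * g x)
      (\<lambda>x. \<alpha> * wderiv L f x + \<beta> * wderiv L g x)"
    by (intro is_weak_deriv_lincomb)
  with Suc.IH[OF f(1) g(1)] L2_lincomb[OF \<open>f \<in> L2 L\<close> \<open>g \<in> L2 L\<close>]
  show ?case
    by auto
qed

lemma wderiv_lincomb:
  assumes "f \<in> sobolev L (Suc k)" "g \<in> sobolev L (Suc k)"
  shows "AE x in intv L. wderiv L (\<lambda>x. \<alpha> * f x + \<beta> * g x) x
    = \<alpha> * wderiv L f x + \<beta> * wderiv L g x"
proof -
  note f = wderiv_sobolev[OF assms(1)] and g = wderiv_sobolev[OF assms(2)]
  show ?thesis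
    by (intro wderiv_props(3) L2_lincomb f(2) g(2) is_weak_deriv_lincomb f(3) g(3)
        sobolev_subset_L2[OF assms(1)] sobolev_subset_L2[OF assms(2)])
qed

text \<open>This allows an almost-everywhere identity to be differentiated. Nested occurrences of
  \<open>wderiv\<close> need it, since the inner derivative is known only up to a null set.\<close>

lemma wderiv_cong_AE:
  assumes "f \<in> sobolev L (Suc k)" "g \<in> L2 L" "AE x in intv L. f x = g x"
  shows "AE x in intv L. wderiv L f x = wderiv L g x"
proof -
  note f = wderiv_sobolev[OF assms(1)]
  have "is_weak_deriv L g (wderiv L f)"
    by (rule is_weak_deriv_cong_AE[OF f(3) sobolev_subset_L2[OF assms(1)] assms(2) f(2) f(2) assms(3)])
      simp
  then have "AE x in intv L. wderiv L g x = wderiv L f x"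
    by (rule wderiv_props(3)[OF wderiv_sobolev(2)[OF assms(1)]])
  then show ?thesis
    by eventually_elim simp
qed

lemma wderiv_iterate_lincomb:
  assumes "f \<in> sobolev L k" "g \<in> sobolev L k" "j \<le> k"
  shows "AE x in intv L. (wderiv L ^^ j) (\<lambda>x. \<alpha> * f x + \<beta> * g x) x
    = \<alpha> * (wderiv L ^^ j) f x + \<beta> * (wderiv L ^^ j) g x"
  using assms(3)
proof (induction j)
  case (Suc j)
  define F G where "F = (wderiv L ^^ j) f" and "G = (wderiv L ^^ j) g"
  define H where "H = (wderiv L ^^ j) (\<lambda>x. \<alpha> * f x + \<beta> * g x)"
  have k: "k - j = Suc (k - Suc j)"
    using Suc.prems by simp
  have FG: "F \<in> sobolev L (Suc (k - Suc j))" "G \<in> sobolev L (Suc (k - Suc j))"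
    and H: "H \<in> sobolev L (Suc (k - Suc j))"
    unfolding F_def G_def H_def k[symmetric]
    using Suc.prems by (intro sobolev_iterate sobolev_lincomb assms; simp)+
  have "AE x in intv L. H x = \<alpha> * F x + \<beta> * G x"
    using Suc by (simp add: F_def G_def H_def)
  then have "AE x in intv L. wderiv L H x = wderiv L (\<lambda>x. \<alpha> * F x + \<beta> * G x) x"
    by (intro wderiv_cong_AE[OF H] L2_lincomb sobolev_subset_L2[OF FG(1)] sobolev_subset_L2[OF FG(2)])
  with wderiv_lincomb[OF FG, of \<alpha> \<beta>]
  have "AE x in intv L. wderiv L H x = \<alpha> * wderiv L F x + \<beta> * wderiv L G x"
    by eventually_elim simp
  then show ?case
    by (simp add: F_def G_def H_def)
qed simp

text \<open>The inequality with r = 1, applied to every derivative of order at most k and summed.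
  The resulting factor 2 is harmless in density arguments.\<close>

lemma sobolev_norm_lincomb_sq_le:
  assumes "f \<in> sobolev L k" "g \<in> sobolev L k"
  shows "(sobolev_norm L k (\<lambda>x. \<alpha> * f x + \<beta> * g x))\<^sup>2
    \<le> 2 * ((cmod \<alpha>)\<^sup>2 * (sobolev_norm L k f)\<^sup>2) + 2 * ((cmod \<beta>)\<^sup>2 * (sobolev_norm L k g)\<^sup>2)"
proof -
  have sq: "(sobolev_norm L k h)\<^sup>2 = (\<Sum>j\<le>k. (L2_norm L ((wderiv L ^^ j) h))\<^sup>2)" for h
    unfolding sobolev_norm_def by (rule real_sqrt_pow2) (simp add: sum_nonneg)
  have "(L2_norm L ((wderiv L ^^ j) (\<lambda>x. \<alpha> * f x + \<beta> * g x)))\<^sup>2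
      \<le> 2 * ((cmod \<alpha>)\<^sup>2 * (L2_norm L ((wderiv L ^^ j) f))\<^sup>2)
        + 2 * ((cmod \<beta>)\<^sup>2 * (L2_norm L ((wderiv L ^^ j) g))\<^sup>2)" if "j \<le> k" for j
  proof -
    note f = sobolev_subset_L2[OF sobolev_iterate[OF assms(1) that]]
    note g = sobolev_subset_L2[OF sobolev_iterate[OF assms(2) that]]
    have "L2_norm L ((wderiv L ^^ j) (\<lambda>x. \<alpha> * f x + \<beta> * g x))
        = L2_norm L (\<lambda>x. \<alpha> * (wderiv L ^^ j) f x + \<beta> * (wderiv L ^^ j) g x)"
      using that assms f g
      by (intro L2_norm_cong_AE wderiv_iterate_lincomb[OF assms that] L2_lincomb
          sobolev_subset_L2[OF sobolev_iterate[OF sobolev_lincomb]]) auto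
    with L2_norm_lincomb_sq_le[OF f g, of 1] show ?thesis
      by simp
  qed
  then show ?thesis
    unfolding sq sum_distrib_left sum.distrib[symmetric] by (intro sum_mono) simp
qed

text \<open>Integration by parts: the boundary terms vanish because a test function is 0 at both end
  points.\<close>

lemma classical_weak_deriv:
  assumes deriv: "\<And>x. (f has_vector_derivative f' x) (at x)" and cont: "continuous_on UNIV f'"
  shows "is_weak_deriv L f f'"
  unfolding is_weak_deriv_def
proof
  fix \<phi> assume \<phi>: "\<phi> \<in> test_fun L"
  show "(LINT x|intv L. f x * vderiv \<phi> x) = - (LINT x|intv L. f' x * \<phi> x)"
  proof (cases "0 < L")
    case False
    then have "space (intv L) = {}" by simp
    then show ?thesis by (simp add: Bochner_Integration.integral_empty)
  next
    case True
    have f: "continuous_on UNIV f"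
      using deriv by (auto simp: continuous_on_eq_continuous_within
          intro: has_vector_derivative_continuous)
    have int: "integrable (intv L) (\<lambda>x. f x * vderiv \<phi> x)" "integrable (intv L) (\<lambda>x. f' x * \<phi> x)"
      by (intro L2_integrable_mult continuous_L2 f cont test_fun_continuous[OF \<phi>])+
    have "((\<lambda>x. f x * vderiv \<phi> x + f' x * \<phi> x) has_integral (f L * \<phi> L - f 0 * \<phi> 0)) {0..L}"
      using True deriv test_fun_has_vderiv[OF \<phi>]
      by (intro fundamental_theorem_of_calculus[where f = "\<lambda>x. f x * \<phi> x"])
        (auto intro: has_vector_derivative_mult has_vector_derivative_at_within)
    moreover have "\<phi> L = 0" "\<phi> 0 = 0"
      using test_fun_eq_0[OF \<phi>] by auto
    ultimately have "((\<lambda>x. f x * vderiv \<phi> x + f' x * \<phi> x) has_integral 0) {0<..<L}"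
      by (simp add: has_integral_Icc_iff_Ioo)
    then have "integral {0<..<L} (\<lambda>x. f x * vderiv \<phi> x + f' x * \<phi> x) = 0"
      by blast
    then have "(LINT x|intv L. f x * vderiv \<phi> x + f' x * \<phi> x) = 0"
      using int by (subst lebesgue_integral_eq_integral) auto
    with int show ?thesis
      by (simp add: add_eq_0_iff)
  qed
qed

lemma classical_sobolev:
  assumes "\<And>m x. m < k \<Longrightarrow> (vderiv ^^ m) f differentiable (at x)"
    and "continuous_on UNIV ((vderiv ^^ k) f)"
  shows "f \<in> sobolev L k"
  using assms
proof (induction k arbitrary: f)
  case 0
  then show ?case by (simp add: continuous_L2)
next
  case (Suc k)
  have diff: "f differentiable (at x)" for x
    using Suc.prems(1)[of 0] by simp
  have f: "continuous_on UNIV f"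
    using diff by (auto simp: continuous_on_eq_continuous_within
        intro: differentiable_imp_continuous_within)
  have swap: "(vderiv ^^ m) (vderiv f) = (vderiv ^^ Suc m) f" for m
    by (simp add: funpow_swap1)
  have "vderiv f \<in> sobolev L k"
    by (rule Suc.IH) (use Suc.prems in \<open>auto simp only: swap Suc_less_eq\<close>)
  moreover have "continuous_on UNIV (vderiv f)"
  proof (cases k)
    case 0
    then show ?thesis using Suc.prems(2) by simp
  next
    case (Suc m)
    then show ?thesis
      using Suc.prems(1)[of 1] by (auto simp: continuous_on_eq_continuous_within
        intro: differentiable_imp_continuous_within)
  qed
  then have "is_weak_deriv L f (vderiv f)"
    using diff by (intro classical_weak_deriv) (auto simp: vderiv_def vector_derivative_works)
  ultimately show ?case
    using continuous_L2[OF f] by auto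
qed

lemma test_fun_subset_sobolev: "test_fun L \<subseteq> sobolev L k"
proof
  fix \<phi> assume \<phi>: "\<phi> \<in> test_fun L"
  then show "\<phi> \<in> sobolev L k"
    by (intro classical_sobolev) (auto simp: continuous_on_eq_continuous_within
        intro: test_fun_differentiable differentiable_imp_continuous_within)
qed

section \<open>Linearity of the closure of the test functions\<close>

lemma sobolev0_lincomb:
  assumes "f \<in> sobolev0 L k" "g \<in> sobolev0 L k"
  shows "(\<lambda>x. \<alpha> * f x + \<beta> * g x) \<in> sobolev0 L k"
proof -
  have fg: "f \<in> sobolev L k" "g \<in> sobolev L k"
    using assms by (auto simp: sobolev0_def)
  have "\<exists>\<phi>\<in>test_fun L. sobolev_norm L k (\<lambda>x. \<alpha> * f x + \<beta> * g x - \<phi> x) < \<epsilon>"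
    if "0 < \<epsilon>" for \<epsilon>
  proof -
    \<comment> \<open>The factor 2 absorbs the square root of 2 coming from the squared-norm
      inequality, and the summand 1 keeps the denominator positive when both coefficients are
      0.\<close>
    define \<delta> where "\<delta> = \<epsilon> / (2 * (cmod \<alpha> + cmod \<beta> + 1))"
    have pos: "0 < cmod \<alpha> + cmod \<beta> + 1"
      using norm_ge_zero[of \<alpha>] norm_ge_zero[of \<beta>] by linarith
    have "0 < \<delta>"
      using that pos by (simp add: \<delta>_def)
    obtain \<phi> where \<phi>: "\<phi> \<in> test_fun L" "sobolev_norm L k (\<lambda>x. f x - \<phi> x) < \<delta>"
      using assms(1) \<open>0 < \<delta>\<close> by (auto simp: sobolev0_def)
    obtain \<psi> where \<psi>: "\<psi> \<in> test_fun L" "sobolev_norm L k (\<lambda>x. g x - \<psi> x) < \<delta>"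
      using assms(2) \<open>0 < \<delta>\<close> by (auto simp: sobolev0_def)
    define u v where "u = (\<lambda>x. f x - \<phi> x)" and "v = (\<lambda>x. g x - \<psi> x)"
    have uv: "u \<in> sobolev L k" "v \<in> sobolev L k"
      using sobolev_lincomb[OF fg(1) subsetD[OF test_fun_subset_sobolev \<phi>(1)], of 1 "- 1"]
        sobolev_lincomb[OF fg(2) subsetD[OF test_fun_subset_sobolev \<psi>(1)], of 1 "- 1"]
      by (simp_all add: u_def v_def)
    have nonneg: "0 \<le> sobolev_norm L k h" for h
      by (simp add: sobolev_norm_def sum_nonneg)
    define \<theta> where "\<theta> = (\<lambda>x. \<alpha> * \<phi> x + \<beta> * \<psi> x)"
    have "(sobolev_norm L k (\<lambda>x. \<alpha> * u x + \<beta> * v x))\<^sup>2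
        \<le> 2 * ((cmod \<alpha>)\<^sup>2 * (sobolev_norm L k u)\<^sup>2) + 2 * ((cmod \<beta>)\<^sup>2 * (sobolev_norm L k v)\<^sup>2)"
      by (rule sobolev_norm_lincomb_sq_le[OF uv])
    also have "\<dots> \<le> 2 * ((cmod \<alpha>)\<^sup>2 * \<delta>\<^sup>2) + 2 * ((cmod \<beta>)\<^sup>2 * \<delta>\<^sup>2)"
      using \<phi>(2) \<psi>(2) nonneg
      by (intro add_mono mult_left_mono power_mono) (auto simp: u_def v_def)
    also have "\<dots> \<le> 2 * (cmod \<alpha> + cmod \<beta>)\<^sup>2 * \<delta>\<^sup>2"
      by (simp add: power2_sum algebra_simps)
    also have "\<dots> < 4 * (cmod \<alpha> + cmod \<beta> + 1)\<^sup>2 * \<delta>\<^sup>2"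
    proof (rule mult_strict_right_mono)
      have "(cmod \<alpha> + cmod \<beta>)\<^sup>2 < (cmod \<alpha> + cmod \<beta> + 1)\<^sup>2"
        by (rule power_strict_mono) auto
      then show "2 * (cmod \<alpha> + cmod \<beta>)\<^sup>2 < 4 * (cmod \<alpha> + cmod \<beta> + 1)\<^sup>2"
        using zero_le_power2[of "cmod \<alpha> + cmod \<beta> + 1"] by linarith
    qed (use \<open>0 < \<delta>\<close> in simp)
    also have "\<dots> = (2 * (cmod \<alpha> + cmod \<beta> + 1) * \<delta>)\<^sup>2"
      by (simp only: power_mult_distrib) simp
    also have "2 * (cmod \<alpha> + cmod \<beta> + 1) * \<delta> = \<epsilon>"
      using pos by (simp add: \<delta>_def)
    finally have "sobolev_norm L k (\<lambda>x. \<alpha> * u x + \<beta> * v x) < \<epsilon>"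
      using that by (simp add: power_less_imp_less_base)
    moreover have "(\<lambda>x. \<alpha> * u x + \<beta> * v x) = (\<lambda>x. \<alpha> * f x + \<beta> * g x - \<theta> x)"
      by (auto simp: u_def v_def \<theta>_def algebra_simps)
    moreover have "\<theta> \<in> test_fun L"
      unfolding \<theta>_def by (rule test_fun_lincomb[OF \<phi>(1) \<psi>(1)])
    ultimately show ?thesis
      by auto
  qed
  then show ?thesis
    using sobolev_lincomb[OF fg] by (auto simp: sobolev0_def)
qed


section \<open>Right continuity and right derivatives\<close>

text \<open>A Baire category argument for a pseudometric d on times. \<open>O' n\<close> is the open
  set of points with a neighbourhood of d-diameter below 1/(n+1), up to the strictness of bounds.
  Right continuity at t makes a short interval just to the right of t small, so t lies in the
  closure of \<open>O' n\<close>. A point common to all these dense open sets is a point of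
  two-sided continuity.\<close>

lemma right_continuous_imp_continuity_point:
  fixes d :: "real \<Rightarrow> real \<Rightarrow> real"
  assumes nonneg: "\<And>s t. 0 \<le> d s t"
    and sym: "\<And>s t. a < s \<Longrightarrow> a < t \<Longrightarrow> d s t = d t s"
    and tri: "\<And>r s t. a < r \<Longrightarrow> a < s \<Longrightarrow> a < t \<Longrightarrow> d r t \<le> d r s + d s t"
    and right: "\<And>t. a < t \<Longrightarrow> ((\<lambda>s. d s t) \<longlongrightarrow> 0) (at_right t)"
    and "a < b"
  shows "\<exists>t\<in>{a<..<b}. ((\<lambda>s. d s t) \<longlongrightarrow> 0) (at t)"
proof -
  define small where "small n I \<longleftrightarrow> open I \<and> I \<subseteq> {a<..<b} \<and> (\<forall>s\<in>I. \<forall>t\<in>I. d s t < 1 / real (Suc n))"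
    for n and I :: "real set"
  define O' where "O' n = \<Union>{I. small n I}" for n
  have dense: "{a<..<b} \<subseteq> closure (O' n)" for n
  proof
    fix t assume t: "t \<in> {a<..<b}"
    \<comment> \<open>Two points to the right of t are each within q/2 of t, hence within q of each
      other; t itself need not belong to the interval.\<close>
    define q where "q = 1 / real (Suc n)"
    have "\<forall>\<^sub>F s in at_right t. dist (d s t) 0 < q / 2"
      using right[of t] t by (intro tendstoD) (auto simp: q_def)
    then obtain c where c: "t < c" "\<And>s. t < s \<Longrightarrow> s < c \<Longrightarrow> d s t < q / 2"
      using nonneg by (auto simp: eventually_at_right_field dist_real_def)
    define e where "e = min c b"
    have "small n {t<..<e}"
      unfolding small_def
    proof (intro conjI ballI)
      fix r s assume "r \<in> {t<..<e}" "s \<in> {t<..<e}"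
      then have "d r t < q / 2" "d s t < q / 2"
        using c(2) by (simp_all add: e_def)
      moreover have "d r s \<le> d r t + d s t"
        using tri[of r t s] sym[of s t] t \<open>r \<in> _\<close> \<open>s \<in> _\<close> by auto
      ultimately show "d r s < 1 / real (Suc n)"
        unfolding q_def[symmetric] by linarith
    qed (use t in \<open>auto simp: e_def\<close>)
    then have "{t<..<e} \<subseteq> O' n"
      by (auto simp: O'_def)
    moreover have "t \<in> closure {t<..<e}"
      using c(1) t by (subst closure_greaterThanLessThan) (auto simp: e_def)
    ultimately show "t \<in> closure (O' n)"
      using closure_mono by blast
  qed
  have "{a..b} \<subseteq> closure (\<Inter>(range O'))"
  proof (rule Baire)
    fix T assume "T \<in> range O'"
    then obtain n where T: "T = O' n" by auto
    have "open T" "T \<subseteq> {a<..<b}"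
      by (auto simp: T O'_def small_def)
    then have "openin (top_of_set {a..b}) T"
      by (auto intro!: open_subset)
    moreover have "{a..b} \<subseteq> closure T"
      using closure_mono[OF dense[of n]] \<open>a < b\<close> by (simp add: T)
    ultimately show "openin (top_of_set {a..b}) T \<and> {a..b} \<subseteq> closure T" ..
  qed auto
  then have "\<Inter>(range O') \<noteq> {}"
    using \<open>a < b\<close> by auto
  then obtain t where t: "\<And>n. t \<in> O' n"
    by blast
  have "t \<in> {a<..<b}"
    using t[of 0] by (auto simp: O'_def small_def)
  moreover have "((\<lambda>s. d s t) \<longlongrightarrow> 0) (at t)"
  proof (rule tendstoI)
    fix \<epsilon> :: real assume "0 < \<epsilon>"
    then obtain n where n: "1 / real (Suc n) < \<epsilon>"
      using nat_approx_posE by blast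
    obtain I where I: "small n I" "t \<in> I"
      using t[of n] by (auto simp: O'_def)
    have "\<forall>\<^sub>F s in at t. s \<in> I"
      using I by (auto simp: small_def intro!: eventually_at_in_open')
    then show "\<forall>\<^sub>F s in at t. dist (d s t) 0 < \<epsilon>"
    proof eventually_elim
      case (elim s)
      then have "d s t < 1 / real (Suc n)"
        using I by (auto simp: small_def)
      with n nonneg[of s t] show ?case
        by simp
    qed
  qed
  ultimately show ?thesis ..
qed

text \<open>For each \<epsilon> > 0 the bound |g r - g 0| \<le> \<epsilon> r is propagated from 0 to
  b by continuous induction: left continuity closes the set of admissible times at its supremum c,
  and the right derivative at c extends it further. Then \<epsilon> tends to 0.\<close>

lemma zero_right_derivative_imp_constant:
  fixes g :: "real \<Rightarrow> real"
  assumes left: "\<And>t. 0 < t \<Longrightarrow> (g \<longlongrightarrow> g t) (at_left t)"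
    and right: "\<And>t. 0 \<le> t \<Longrightarrow> ((\<lambda>h. (g (t + h) - g t) / h) \<longlongrightarrow> 0) (at_right 0)"
    and "0 \<le> b"
  shows "g b = g 0"
proof -
  have "\<bar>g b - g 0\<bar> \<le> \<epsilon> * b" if \<epsilon>: "0 < \<epsilon>" for \<epsilon>
  proof -
    \<comment> \<open>The bound is required on the whole interval up to t, so that \<open>T\<close>
      is an initial segment of the time interval.\<close>
    define T where "T = {t\<in>{0..b}. \<forall>r\<in>{0..t}. \<bar>g r - g 0\<bar> \<le> \<epsilon> * r}"
    define c where "c = Sup T"
    have "0 \<in> T"
      using \<open>0 \<le> b\<close> by (simp add: T_def)
    have bdd: "bdd_above T"
      by (rule bdd_aboveI[of _ b]) (simp add: T_def)
    have "0 \<le> c"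
      unfolding c_def by (rule cSup_upper[OF \<open>0 \<in> T\<close> bdd])
    moreover have "c \<le> b"
      unfolding c_def by (rule cSup_least) (use \<open>0 \<in> T\<close> in \<open>auto simp: T_def\<close>)
    ultimately have c: "0 \<le> c" "c \<le> b"
      by simp_all
    have below: "\<bar>g r - g 0\<bar> \<le> \<epsilon> * r" if r: "0 \<le> r" "r < c" for r
    proof -
      obtain t where "t \<in> T" "r < t"
        using r(2) less_cSup_iff[of T r] \<open>0 \<in> T\<close> bdd by (auto simp: c_def)
      then show ?thesis
        using r by (auto simp: T_def)
    qed
    have at_c: "\<bar>g c - g 0\<bar> \<le> \<epsilon> * c"
    proof (cases "c = 0")
      case False
      with c have "0 < c" by simp
      have "((\<lambda>r. \<bar>g r - g 0\<bar>) \<longlongrightarrow> \<bar>g c - g 0\<bar>) (at_left c)"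
        by (intro tendsto_intros left \<open>0 < c\<close>)
      moreover have "((\<lambda>r. \<epsilon> * r) \<longlongrightarrow> \<epsilon> * c) (at_left c)"
        by (intro tendsto_intros)
      moreover have "\<forall>\<^sub>F r in at_left c. \<bar>g r - g 0\<bar> \<le> \<epsilon> * r"
        using \<open>0 < c\<close> below by (intro eventually_at_leftI[of 0]) auto
      ultimately show ?thesis
        by (intro tendsto_le[where F = "at_left c"]) auto
    qed simp
    have "c = b"
    proof (rule ccontr)
      assume "c \<noteq> b"
      with c have "c < b" by simp
      have "\<forall>\<^sub>F h in at_right 0. dist ((g (c + h) - g c) / h) 0 < \<epsilon>"
        using right[OF c(1)] \<epsilon> by (rule tendstoD)
      then obtain \<delta> where \<delta>: "0 < \<delta>"
        "\<And>h. 0 < h \<Longrightarrow> h < \<delta> \<Longrightarrow> \<bar>(g (c + h) - g c) / h\<bar> < \<epsilon>"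
        unfolding eventually_at_right_field by (auto simp: dist_real_def)
      \<comment> \<open>Half of \<delta> keeps every increment strictly below \<delta>; the other
        bound keeps c + e inside the time interval.\<close>
      define e where "e = min (\<delta> / 2) (b - c)"
      have e: "0 < e" "e < \<delta>" "c + e \<le> b"
        using \<open>c < b\<close> \<open>0 < \<delta>\<close> by (auto simp: e_def min_def)
      have "\<bar>g r - g 0\<bar> \<le> \<epsilon> * r" if r: "0 \<le> r" "r \<le> c + e" for r
      proof -
        consider "r < c" | "r = c" | "c < r" by linarith
        then show ?thesis
        proof cases
          case 3
          then have "\<bar>(g (c + (r - c)) - g c) / (r - c)\<bar> < \<epsilon>"
            using r e by (intro \<delta>(2)) auto
          then have "\<bar>g r - g c\<bar> \<le> \<epsilon> * (r - c)"
            using 3 by (simp add: field_simps)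
          with at_c show ?thesis
            by (simp add: algebra_simps)
        qed (use r below at_c in auto)
      qed
      then have "c + e \<in> T"
        using e c by (auto simp: T_def)
      then have "c + e \<le> c"
        unfolding c_def using bdd by (rule cSup_upper)
      with e show False by simp
    qed
    with at_c show ?thesis by simp
  qed
  then have "\<bar>g b - g 0\<bar> \<le> 0 + \<epsilon>" if "0 < \<epsilon>" for \<epsilon>
    using that \<open>0 \<le> b\<close>
    by (cases "b = 0") (use \<open>\<And>\<epsilon>. 0 < \<epsilon> \<Longrightarrow> \<bar>g b - g 0\<bar> \<le> \<epsilon> * b\<close>[of "\<epsilon> / b"] in auto)
  then have "\<bar>g b - g 0\<bar> \<le> 0"
    by (rule field_le_epsilon)
  then show ?thesis
    by simp
qed


section \<open>The energy norm\<close>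

text \<open>Every term of the energy norm is a weighted squared \<open>L2_norm\<close> of such an
  observable. Linearity is required only almost everywhere because \<open>wderiv\<close> offers no
  more, and compatibility with \<open>state_eq\<close> makes the norm well defined on represented
  elements.\<close>

definition linear_obs :: "beam \<Rightarrow> (state \<Rightarrow> real \<Rightarrow> complex) \<Rightarrow> bool" where
  "linear_obs p T \<longleftrightarrow>
     (\<forall>U\<in>energy_space p. T U \<in> L2 (len p)) \<and>
     (\<forall>U\<in>energy_space p. \<forall>V\<in>energy_space p. \<forall>\<alpha> \<beta>.
        AE x in intv (len p). T (lincomb \<alpha> U \<beta> V) x = \<alpha> * T U x + \<beta> * T V x) \<and>
     (\<forall>U\<in>energy_space p. \<forall>V\<in>energy_space p.
        state_eq p U V \<longrightarrow> (AE x in intv (len p). T U x = T V x))"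

lemma sobolev0_subset: "f \<in> sobolev0 L k \<Longrightarrow> f \<in> sobolev L k"
  by (simp add: sobolev0_def)

lemma sobolev_Suc_subset: "f \<in> sobolev L (Suc k) \<Longrightarrow> f \<in> sobolev L k"
proof (induction k arbitrary: f)
  case (Suc k)
  then obtain g where "f \<in> L2 L" "g \<in> sobolev L (Suc k)" "is_weak_deriv L f g"
    by (auto simp del: sobolev.simps(2) simp: sobolev.simps(2)[of L "Suc k"])
  with Suc.IH[of g] show ?case
    by (auto simp: sobolev.simps(2)[of L k] simp del: sobolev.simps(2))
qed simp

lemma energy_space_lincomb:
  assumes "U \<in> energy_space p" "V \<in> energy_space p"
  shows "lincomb \<alpha> U \<beta> V \<in> energy_space p"
  using assms by (auto simp: energy_space_def lincomb_def intro: L2_lincomb sobolev0_lincomb)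

lemma energy_space_components:
  assumes "U \<in> energy_space p"
  shows "u1 U \<in> sobolev (len p) (Suc 0)" "y1 U \<in> sobolev (len p) (Suc 0)"
    "w U \<in> sobolev (len p) (Suc (Suc 0))" "u3 U \<in> sobolev (len p) (Suc 0)"
    "y3 U \<in> sobolev (len p) (Suc 0)"
    "v1 U \<in> L2 (len p)" "z1 U \<in> L2 (len p)" "psi U \<in> L2 (len p)"
    "v3 U \<in> L2 (len p)" "z3 U \<in> L2 (len p)"
  using assms unfolding energy_space_def One_nat_def numeral_2_eq_2
  by (blast intro: sobolev0_subset)+

lemma linear_obs_components:
  "T \<in> {u1, v1, y1, z1, w, psi, u3, v3, y3, z3} \<Longrightarrow> linear_obs p T"
  by (auto simp: linear_obs_def lincomb_def state_eq_def
      simp del: sobolev.simps intro: energy_space_components sobolev_subset_L2)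

lemma linear_obs_wderiv:
  assumes T: "linear_obs p T"
    and H1: "\<And>U. U \<in> energy_space p \<Longrightarrow> T U \<in> sobolev (len p) (Suc 0)"
  shows "linear_obs p (\<lambda>U. wderiv (len p) (T U))"
  unfolding linear_obs_def
proof (intro conjI ballI allI impI)
  fix U assume U: "U \<in> energy_space p"
  show "wderiv (len p) (T U) \<in> L2 (len p)"
    by (rule wderiv_sobolev(2)[OF H1[OF U]])
  fix V assume V: "V \<in> energy_space p"
  {
    assume "state_eq p U V"
    then have "AE x in intv (len p). T U x = T V x"
      using T U V by (simp add: linear_obs_def)
    then show "AE x in intv (len p). wderiv (len p) (T U) x = wderiv (len p) (T V) x"
      by (rule wderiv_cong_AE[OF H1[OF U] sobolev_subset_L2[OF H1[OF V]]])
  }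
  fix \<alpha> \<beta>
  have "AE x in intv (len p). T (lincomb \<alpha> U \<beta> V) x = \<alpha> * T U x + \<beta> * T V x"
    using T U V by (simp add: linear_obs_def)
  then have "AE x in intv (len p). wderiv (len p) (T (lincomb \<alpha> U \<beta> V)) x
      = wderiv (len p) (\<lambda>x. \<alpha> * T U x + \<beta> * T V x) x"
    by (rule wderiv_cong_AE[OF H1[OF energy_space_lincomb[OF U V]]
          L2_lincomb[OF sobolev_subset_L2[OF H1[OF U]] sobolev_subset_L2[OF H1[OF V]]]])
  with wderiv_lincomb[OF H1[OF U] H1[OF V], of \<alpha> \<beta>]
  show "AE x in intv (len p). wderiv (len p) (T (lincomb \<alpha> U \<beta> V)) x
      = \<alpha> * wderiv (len p) (T U) x + \<beta> * wderiv (len p) (T V) x"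
    by eventually_elim simp
qed

lemma linear_obs_lincomb:
  assumes S: "linear_obs p S" and T: "linear_obs p T"
  shows "linear_obs p (\<lambda>U x. a * S U x + b * T U x)"
  unfolding linear_obs_def
proof (intro conjI ballI allI impI)
  fix U assume U: "U \<in> energy_space p"
  show "(\<lambda>x. a * S U x + b * T U x) \<in> L2 (len p)"
    using assms U by (intro L2_lincomb) (auto simp: linear_obs_def)
  fix V assume V: "V \<in> energy_space p"
  {
    assume "state_eq p U V"
    then have "AE x in intv (len p). S U x = S V x" "AE x in intv (len p). T U x = T V x"
      using assms U V by (simp_all add: linear_obs_def)
    then show "AE x in intv (len p). a * S U x + b * T U x = a * S V x + b * T V x"
      by eventually_elim simp
  }
  fix \<alpha> \<beta>
  have "AE x in intv (len p). S (lincomb \<alpha> U \<beta> V) x = \<alpha> * S U x + \<beta> * S V x"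
    "AE x in intv (len p). T (lincomb \<alpha> U \<beta> V) x = \<alpha> * T U x + \<beta> * T V x"
    using assms U V by (simp_all add: linear_obs_def)
  then show "AE x in intv (len p). a * S (lincomb \<alpha> U \<beta> V) x + b * T (lincomb \<alpha> U \<beta> V) x
      = \<alpha> * (a * S U x + b * T U x) + \<beta> * (a * S V x + b * T V x)"
    by eventually_elim (simp add: algebra_simps)
qed

lemma linear_obs_wderiv_w: "linear_obs p (\<lambda>U. wderiv (len p) (w U))"
  by (rule linear_obs_wderiv[OF linear_obs_components])
    (simp, rule sobolev_Suc_subset[OF energy_space_components(3)])

lemma linear_obs_tau: "linear_obs p (tau p)"
proof -
  \<comment> \<open>The tension is spelled out as nested binary combinations with complex
    coefficients, the shape that \<open>linear_obs_lincomb\<close> accepts.\<close>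
  have "linear_obs p (\<lambda>U x. 1 * (1 * (- 1 * u1 U x + 1 * u3 U x)
      + of_real (h2 p) * wderiv (len p) (w U) x)
      + (- 1) * (of_real (h1 p / 2) * y1 U x + of_real (h3 p / 2) * y3 U x))"
    by (intro linear_obs_lincomb linear_obs_components linear_obs_wderiv_w) auto
  also have "(\<lambda>U x. 1 * (1 * (- 1 * u1 U x + 1 * u3 U x)
      + of_real (h2 p) * wderiv (len p) (w U) x)
      + (- 1) * (of_real (h1 p / 2) * y1 U x + of_real (h3 p / 2) * y3 U x)) = tau p"
    by (intro ext) (simp add: tau_def scaleR_conv_of_real)
  finally show ?thesis .
qed

lemma linear_obs_shear: "linear_obs p (shear1 p)" "linear_obs p (shear3 p)"
proof -
  have "linear_obs p (\<lambda>U x. 1 * wderiv (len p) (w U) x + 1 * y1 U x)"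
    "linear_obs p (\<lambda>U x. 1 * wderiv (len p) (w U) x + 1 * y3 U x)"
    by (intro linear_obs_lincomb linear_obs_components linear_obs_wderiv_w; simp)+
  then show "linear_obs p (shear1 p)" "linear_obs p (shear3 p)"
    by (simp_all add: shear1_def[abs_def] shear3_def[abs_def])
qed

text \<open>Listing the weights with their observables lets each property of the energy norm be
  checked once for a generic term instead of thirteen times.\<close>

definition energy_terms :: "beam \<Rightarrow> (real \<times> (state \<Rightarrow> real \<Rightarrow> complex)) list" where
  "energy_terms p = (let D = wderiv (len p) in
     [(E1 p * h1 p, \<lambda>U. D (u1 U)), (rho1 p * h1 p, v1),
      (E3 p * h3 p, \<lambda>U. D (u3 U)), (rho3 p * h3 p, v3),
      (EI p, \<lambda>U. D (D (w U))), (rho_h p, psi),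
      (E1 p * I1 p, \<lambda>U. D (y1 U)), (rho1 p * I1 p, z1),
      (E3 p * I3 p, \<lambda>U. D (y3 U)), (rho3 p * I3 p, z3),
      (G1 p * h1 p, shear1 p), (1, tau p), (G3 p * h3 p, shear3 p)])"

lemma energy_norm_eq_sum:
  "energy_norm p U = sqrt (\<Sum>(c, T)\<leftarrow>energy_terms p. c * (L2_norm (len p) (T U))\<^sup>2)"
  by (simp add: energy_norm_def energy_terms_def Let_def add.assoc)

lemma energy_terms_props:
  assumes "admissible p" "(c, T) \<in> set (energy_terms p)"
  shows "0 \<le> c" "linear_obs p T"
proof -
  note adm = assms(1)[unfolded admissible_def]
  have "0 \<le> EI p" "0 \<le> rho_h p"
    using adm by (auto simp: EI_def rho_h_def)
  with assms(2) adm show "0 \<le> c"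
    by (auto simp: energy_terms_def Let_def)
  have "linear_obs p (\<lambda>U. wderiv (len p) (wderiv (len p) (w U)))"
    by (rule linear_obs_wderiv[OF linear_obs_wderiv_w])
      (rule wderiv_sobolev(1)[OF energy_space_components(3)])
  moreover have "linear_obs p (\<lambda>U. wderiv (len p) (u1 U))" "linear_obs p (\<lambda>U. wderiv (len p) (u3 U))"
    "linear_obs p (\<lambda>U. wderiv (len p) (y1 U))" "linear_obs p (\<lambda>U. wderiv (len p) (y3 U))"
    by (rule linear_obs_wderiv[OF linear_obs_components energy_space_components(1)], simp, assumption,
        rule linear_obs_wderiv[OF linear_obs_components energy_space_components(4)], simp, assumption,
        rule linear_obs_wderiv[OF linear_obs_components energy_space_components(2)], simp, assumption,
        rule linear_obs_wderiv[OF linear_obs_components energy_space_components(5)], simp, assumption)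
  ultimately show "linear_obs p T"
    using assms(2) linear_obs_tau linear_obs_shear linear_obs_components
    by (auto simp: energy_terms_def Let_def)
qed

section \<open>The energy norm as a seminorm that respects equality of states\<close>

lemma energy_norm_nonneg:
  assumes "admissible p"
  shows "0 \<le> energy_norm p U"
  unfolding energy_norm_eq_sum
  by (intro real_sqrt_ge_zero sum_list_nonneg) (auto dest: energy_terms_props(1)[OF assms])

lemma energy_norm_sq:
  assumes "admissible p"
  shows "(energy_norm p U)\<^sup>2 = (\<Sum>(c, T)\<leftarrow>energy_terms p. c * (L2_norm (len p) (T U))\<^sup>2)"
  unfolding energy_norm_eq_sum
  by (intro real_sqrt_pow2 sum_list_nonneg) (auto dest: energy_terms_props(1)[OF assms])

lemma energy_norm_cong:
  assumes "admissible p" "U \<in> energy_space p" "V \<in> energy_space p" "state_eq p U V"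
  shows "energy_norm p U = energy_norm p V"
proof -
  have "L2_norm (len p) (T U) = L2_norm (len p) (T V)" if "(c, T) \<in> set (energy_terms p)" for c T
    using energy_terms_props(2)[OF assms(1) that] assms(2-)
    by (intro L2_norm_cong_AE) (auto simp: linear_obs_def)
  then show ?thesis
    unfolding energy_norm_eq_sum
    by (intro arg_cong[where f = sqrt] arg_cong[where f = sum_list] map_cong) auto
qed

text \<open>For positive a and b the optimal parameter is r = b/a, which turns the right-hand side
  into (a + b)^2. Enlarging both by e/2 makes this choice possible when one of them is 0.\<close>

lemma young_imp_le_sum:
  fixes a b q :: real
  assumes ab: "0 \<le> a" "0 \<le> b"
    and young: "\<And>r. 0 < r \<Longrightarrow> q\<^sup>2 \<le> (1 + r) * a\<^sup>2 + (1 + 1 / r) * b\<^sup>2"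
  shows "q \<le> a + b"
proof (rule field_le_epsilon)
  fix e :: real assume e: "0 < e"
  define s t where "s = a + e / 2" and "t = b + e / 2"
  have st: "0 < s" "0 < t" "a \<le> s" "b \<le> t"
    using ab e by (simp_all add: s_def t_def)
  have eq: "1 + t / s = (s + t) / s" "1 + 1 / (t / s) = (s + t) / t"
    using st by (simp_all add: add_divide_distrib)
  have "(s + t) / s * a\<^sup>2 \<le> (s + t) / s * s\<^sup>2" "(s + t) / t * b\<^sup>2 \<le> (s + t) / t * t\<^sup>2"
    by (intro mult_left_mono power_mono; use st ab in simp)+
  then have "(s + t) / s * a\<^sup>2 + (s + t) / t * b\<^sup>2 \<le> (s + t) / s * s\<^sup>2 + (s + t) / t * t\<^sup>2"
    by (rule add_mono)
  also have "\<dots> = (s + t)\<^sup>2"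
    using st by (simp add: power2_eq_square distrib_left)
  finally have "q\<^sup>2 \<le> (s + t)\<^sup>2"
    using young[of "t / s"] st unfolding eq by simp
  then have "q \<le> s + t"
    by (rule power2_le_imp_le) (use st in simp)
  then show "q \<le> a + b + e"
    by (simp add: s_def t_def)
qed

text \<open>Minkowski's inequality without an inner product: the Young inequalities of all terms are
  added with the same r, and only the sum is optimized over r.\<close>

lemma energy_norm_lincomb:
  assumes p: "admissible p" and U: "U \<in> energy_space p" and V: "V \<in> energy_space p"
  shows "energy_norm p (lincomb \<alpha> U \<beta> V) \<le> cmod \<alpha> * energy_norm p U + cmod \<beta> * energy_norm p V"
proof -
  define W where "W = lincomb \<alpha> U \<beta> V"
  define a b where "a = cmod \<alpha> * energy_norm p U" and "b = cmod \<beta> * energy_norm p V"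
  have ab: "0 \<le> a" "0 \<le> b"
    by (simp_all add: a_def b_def energy_norm_nonneg[OF p])
  have young: "(energy_norm p W)\<^sup>2 \<le> (1 + r) * a\<^sup>2 + (1 + 1 / r) * b\<^sup>2" if r: "0 < r" for r
  proof -
    have "c * (L2_norm (len p) (T W))\<^sup>2
        \<le> (1 + r) * (cmod \<alpha>)\<^sup>2 * (c * (L2_norm (len p) (T U))\<^sup>2)
          + (1 + 1 / r) * (cmod \<beta>)\<^sup>2 * (c * (L2_norm (len p) (T V))\<^sup>2)"
      if cT: "(c, T) \<in> set (energy_terms p)" for c T
    proof -
      note props = energy_terms_props[OF p cT]
      have TU: "T U \<in> L2 (len p)" and TV: "T V \<in> L2 (len p)" and TW: "T W \<in> L2 (len p)"
        and AE: "AE x in intv (len p). T W x = \<alpha> * T U x + \<beta> * T V x"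
        using props(2) U V energy_space_lincomb[OF U V] by (auto simp: linear_obs_def W_def)
      have "(L2_norm (len p) (T W))\<^sup>2 = (L2_norm (len p) (\<lambda>x. \<alpha> * T U x + \<beta> * T V x))\<^sup>2"
        using L2_norm_cong_AE[OF TW L2_lincomb[OF TU TV] AE] by simp
      also have "\<dots> \<le> (1 + r) * ((cmod \<alpha>)\<^sup>2 * (L2_norm (len p) (T U))\<^sup>2)
          + (1 + 1 / r) * ((cmod \<beta>)\<^sup>2 * (L2_norm (len p) (T V))\<^sup>2)"
        by (rule L2_norm_lincomb_sq_le[OF TU TV r])
      finally show ?thesis
        using mult_left_mono[OF _ props(1)] by (fastforce simp: algebra_simps)
    qed
    then have "(energy_norm p W)\<^sup>2 \<le> (\<Sum>(c, T)\<leftarrow>energy_terms p.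
        (1 + r) * (cmod \<alpha>)\<^sup>2 * (c * (L2_norm (len p) (T U))\<^sup>2)
          + (1 + 1 / r) * (cmod \<beta>)\<^sup>2 * (c * (L2_norm (len p) (T V))\<^sup>2))"
      unfolding energy_norm_sq[OF p] by (intro sum_list_mono) auto
    also have "\<dots> = (1 + r) * (cmod \<alpha>)\<^sup>2 * (energy_norm p U)\<^sup>2
        + (1 + 1 / r) * (cmod \<beta>)\<^sup>2 * (energy_norm p V)\<^sup>2"
      unfolding energy_norm_sq[OF p]
      by (simp add: case_prod_unfold sum_list_addf sum_list_const_mult)
    finally show ?thesis
      by (simp add: a_def b_def power_mult_distrib algebra_simps)
  qed
  have "energy_norm p W \<le> a + b"
    using ab young by (rule young_imp_le_sum)
  then show ?thesis
    by (simp add: W_def a_def b_def)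
qed

lemma state_eq_lincomb:
  assumes "state_eq p U U'" "state_eq p V V'"
  shows "state_eq p (lincomb \<alpha> U \<beta> V) (lincomb \<alpha> U' \<beta> V')"
  unfolding state_eq_def
proof
  fix f :: "state \<Rightarrow> real \<Rightarrow> complex"
  assume f: "f \<in> {u1, v1, y1, z1, w, psi, u3, v3, y3, z3}"
  have comb: "f (lincomb \<alpha> A \<beta> B) = (\<lambda>x. \<alpha> * f A x + \<beta> * f B x)" for A B
    using f by (auto simp: lincomb_def)
  have "AE x in intv (len p). f U x = f U' x" "AE x in intv (len p). f V x = f V' x"
    using assms f unfolding state_eq_def by blast+
  then show "AE x in intv (len p). f (lincomb \<alpha> U \<beta> V) x = f (lincomb \<alpha> U' \<beta> V') x"
    unfolding comb by eventually_elim simp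
qed


section \<open>Orbits of eigenvectors\<close>

definition orbit_dist :: "beam \<Rightarrow> (real \<Rightarrow> state \<Rightarrow> state) \<Rightarrow> state \<Rightarrow> real \<Rightarrow> real \<Rightarrow> real" where
  "orbit_dist p S U s t = energy_norm p (state_diff (S s U) (S t U))"

lemma c0_semigroupD:
  assumes "c0_semigroup p S" "U \<in> energy_space p"
  shows c0_semigroup_mem: "0 \<le> t \<Longrightarrow> S t U \<in> energy_space p"
    and c0_semigroup_linear: "0 \<le> t \<Longrightarrow> V \<in> energy_space p \<Longrightarrow>
      state_eq p (S t (lincomb \<alpha> U \<beta> V)) (lincomb \<alpha> (S t U) \<beta> (S t V))"
    and c0_semigroup_0: "state_eq p (S 0 U) U"
    and c0_semigroup_add: "0 \<le> t \<Longrightarrow> 0 \<le> s \<Longrightarrow> state_eq p (S (t + s) U) (S t (S s U))"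
    and c0_semigroup_tendsto: "((\<lambda>t. energy_norm p (state_diff (S t U) U)) \<longlongrightarrow> 0) (at_right 0)"
  using assms unfolding c0_semigroup_def by (elim conjE; simp)+

lemma c0_semigroup_bound:
  assumes "c0_semigroup p S" "0 \<le> t"
  shows "\<exists>M. \<forall>U\<in>energy_space p. energy_norm p (S t U) \<le> M * energy_norm p U"
  using assms unfolding c0_semigroup_def by (elim conjE) simp

text \<open>By the semigroup law and linearity the left combination is \<open>S r\<close> applied to
  the right one, up to null sets. The constant depends on neither the times nor the coefficients, so
  estimates near time 0 carry over to time r.\<close>

lemma c0_semigroup_shift:
  assumes p: "admissible p" and S: "c0_semigroup p S" and U: "U \<in> energy_space p" and "0 \<le> r"
  shows "\<exists>M\<ge>0. \<forall>s\<ge>0. \<forall>t\<ge>0. \<forall>\<alpha> \<beta>.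
    energy_norm p (lincomb \<alpha> (S (r + s) U) \<beta> (S (r + t) U))
      \<le> M * energy_norm p (lincomb \<alpha> (S s U) \<beta> (S t U))"
proof -
  obtain M where M: "\<And>V. V \<in> energy_space p \<Longrightarrow> energy_norm p (S r V) \<le> M * energy_norm p V"
    using c0_semigroup_bound[OF S \<open>0 \<le> r\<close>] by blast
  \<comment> \<open>Replacing M by \<open>max M 0\<close> gives a nonnegative constant, as needed
    when later inequalities are multiplied by it.\<close>
  have "energy_norm p (lincomb \<alpha> (S (r + s) U) \<beta> (S (r + t) U))
      \<le> max M 0 * energy_norm p (lincomb \<alpha> (S s U) \<beta> (S t U))" if "0 \<le> s" "0 \<le> t" for s t \<alpha> \<beta>
  proof -
    define X Y where "X = S s U" and "Y = S t U"
    have XY: "X \<in> energy_space p" "Y \<in> energy_space p"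
      unfolding X_def Y_def by (intro c0_semigroup_mem[OF S U] that)+
    define W where "W = lincomb \<alpha> X \<beta> Y"
    have W: "W \<in> energy_space p"
      unfolding W_def by (intro energy_space_lincomb XY)
    have r: "S r V \<in> energy_space p" if "V \<in> energy_space p" for V
      by (rule c0_semigroup_mem[OF S that \<open>0 \<le> r\<close>])
    have sum: "S (r + s) U \<in> energy_space p" "S (r + t) U \<in> energy_space p"
      using that \<open>0 \<le> r\<close> by (auto intro: c0_semigroup_mem[OF S U])
    have "state_eq p (S (r + s) U) (S r X)" "state_eq p (S (r + t) U) (S r Y)"
      unfolding X_def Y_def by (intro c0_semigroup_add[OF S U \<open>0 \<le> r\<close>] that)+
    then have "energy_norm p (lincomb \<alpha> (S (r + s) U) \<beta> (S (r + t) U))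
        = energy_norm p (lincomb \<alpha> (S r X) \<beta> (S r Y))"
      by (intro energy_norm_cong p energy_space_lincomb state_eq_lincomb sum r XY)
    also have "\<dots> = energy_norm p (S r W)"
      using c0_semigroup_linear[OF S XY(1) \<open>0 \<le> r\<close> XY(2)]
      by (intro energy_norm_cong[OF p, symmetric] energy_space_lincomb r XY W) (simp add: W_def)
    also have "\<dots> \<le> M * energy_norm p W"
      by (rule M[OF W])
    also have "\<dots> \<le> max M 0 * energy_norm p W"
      by (intro mult_right_mono energy_norm_nonneg p) simp
    finally show ?thesis
      by (simp add: W_def X_def Y_def)
  qed
  then show ?thesis
    by (intro exI[of _ "max M 0"]) auto
qed

text \<open>\<open>S 0 U\<close> and \<open>U\<close> represent the same element but need not be the
  same functions, so they can be exchanged only under the norm.\<close>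

lemma c0_semigroup_lincomb_0:
  assumes p: "admissible p" and S: "c0_semigroup p S" and U: "U \<in> energy_space p" and "0 \<le> s"
  shows "energy_norm p (lincomb \<alpha> (S s U) \<beta> (S 0 U)) = energy_norm p (lincomb \<alpha> (S s U) \<beta> U)"
proof -
  have "state_eq p (S 0 U) U"
    by (rule c0_semigroup_0[OF S U])
  moreover have "state_eq p (S s U) (S s U)"
    by (simp add: state_eq_def)
  moreover have "S s U \<in> energy_space p" "S 0 U \<in> energy_space p"
    using \<open>0 \<le> s\<close> by (auto intro: c0_semigroup_mem[OF S U])
  ultimately show ?thesis
    using U by (intro energy_norm_cong p energy_space_lincomb state_eq_lincomb)
qed

lemma orbit_dist_sym:
  assumes p: "admissible p" and S: "c0_semigroup p S" and U: "U \<in> energy_space p"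
    and "0 \<le> s" "0 \<le> t"
  shows "orbit_dist p S U s t = orbit_dist p S U t s"
proof -
  have "orbit_dist p S U a b \<le> orbit_dist p S U b a" if "0 \<le> a" "0 \<le> b" for a b
  proof -
    define X Y where "X = S a U" and "Y = S b U"
    have XY: "X \<in> energy_space p" "Y \<in> energy_space p"
      unfolding X_def Y_def by (intro c0_semigroup_mem[OF S U] that)+
    have "state_diff X Y = lincomb (- 1) (state_diff Y X) 0 X"
      by (simp add: lincomb_def)
    then show ?thesis
      using energy_norm_lincomb[OF p energy_space_lincomb[OF XY(2,1), of 1 "- 1"] XY(1), of "- 1" 0]
      by (simp add: orbit_dist_def X_def Y_def)
  qed
  with assms show ?thesis
    by (intro antisym) auto
qed

lemma orbit_dist_triangle:
  assumes p: "admissible p" and S: "c0_semigroup p S" and U: "U \<in> energy_space p"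
    and "0 \<le> r" "0 \<le> s" "0 \<le> t"
  shows "orbit_dist p S U r t \<le> orbit_dist p S U r s + orbit_dist p S U s t"
proof -
  define X Y Z where "X = S r U" and "Y = S s U" and "Z = S t U"
  have XYZ: "X \<in> energy_space p" "Y \<in> energy_space p" "Z \<in> energy_space p"
    unfolding X_def Y_def Z_def by (intro c0_semigroup_mem[OF S U] assms)+
  have "state_diff X Z = lincomb 1 (state_diff X Y) 1 (state_diff Y Z)"
    by (simp add: lincomb_def)
  then show ?thesis
    using energy_norm_lincomb[OF p energy_space_lincomb[OF XYZ(1,2), of 1 "- 1"]
        energy_space_lincomb[OF XYZ(2,3), of 1 "- 1"], of 1 1]
    by (simp add: orbit_dist_def X_def Y_def Z_def)
qed

text \<open>The shift estimate with base time t reduces this to the continuity at 0 that the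
  semigroup axioms provide.\<close>

lemma orbit_dist_right_tendsto:
  assumes p: "admissible p" and S: "c0_semigroup p S" and U: "U \<in> energy_space p" and "0 \<le> t"
  shows "((\<lambda>s. orbit_dist p S U s t) \<longlongrightarrow> 0) (at_right t)"
proof -
  obtain M where M: "0 \<le> M" "\<And>h \<alpha> \<beta>. 0 \<le> h \<Longrightarrow>
      energy_norm p (lincomb \<alpha> (S (t + h) U) \<beta> (S (t + 0) U))
        \<le> M * energy_norm p (lincomb \<alpha> (S h U) \<beta> (S 0 U))"
    using c0_semigroup_shift[OF p S U \<open>0 \<le> t\<close>] by (metis order_refl)
  have "((\<lambda>h. energy_norm p (state_diff (S h U) U)) \<longlongrightarrow> 0) (at_right 0)"
    by (rule c0_semigroup_tendsto[OF S U])
  then have "((\<lambda>h. M * energy_norm p (state_diff (S h U) U)) \<longlongrightarrow> 0) (at_right 0)"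
    by (rule tendsto_mult_right_zero)
  then have "((\<lambda>h. orbit_dist p S U (h + t) t) \<longlongrightarrow> 0) (at_right 0)"
  proof (rule Lim_null_comparison[rotated])
    show "\<forall>\<^sub>F h in at_right 0. norm (orbit_dist p S U (h + t) t)
        \<le> M * energy_norm p (state_diff (S h U) U)"
      using eventually_at_right_less
    proof eventually_elim
      case (elim h)
      then show ?case
        using M(2)[of h 1 "- 1"] c0_semigroup_lincomb_0[OF p S U, of h 1 "- 1"]
        by (simp add: orbit_dist_def energy_norm_nonneg[OF p] add.commute)
    qed
  qed
  then show ?thesis
    by (subst filterlim_at_right_to_0)
qed

text \<open>Right continuity already forces continuity at a dense set of times, and left continuity is
  transported forward from such a time by the semigroup. This avoids the uniform boundedness
  principle and hence the completeness of the energy space.\<close>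

lemma orbit_dist_left_tendsto:
  assumes p: "admissible p" and S: "c0_semigroup p S" and U: "U \<in> energy_space p" and "0 < t"
  shows "((\<lambda>s. orbit_dist p S U s t) \<longlongrightarrow> 0) (at_left t)"
proof -
  have "\<exists>t0\<in>{0<..<t}. ((\<lambda>s. orbit_dist p S U s t0) \<longlongrightarrow> 0) (at t0)"
  proof (rule right_continuous_imp_continuity_point)
    show "0 \<le> orbit_dist p S U s t" for s t
      by (simp add: orbit_dist_def energy_norm_nonneg[OF p])
  qed (use \<open>0 < t\<close> in \<open>auto intro: orbit_dist_sym[OF p S U] orbit_dist_triangle[OF p S U]
      orbit_dist_right_tendsto[OF p S U]\<close>)
  then obtain t0 where t0: "0 < t0" "t0 < t" "((\<lambda>s. orbit_dist p S U s t0) \<longlongrightarrow> 0) (at t0)"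
    by auto
  define r where "r = t - t0"
  have "0 \<le> r"
    using t0 by (simp add: r_def)
  obtain M where M: "0 \<le> M" "\<And>s \<alpha> \<beta>. 0 \<le> s \<Longrightarrow>
      energy_norm p (lincomb \<alpha> (S (r + s) U) \<beta> (S (r + t0) U))
        \<le> M * energy_norm p (lincomb \<alpha> (S s U) \<beta> (S t0 U))"
    using c0_semigroup_shift[OF p S U \<open>0 \<le> r\<close>] t0(1) by (metis less_imp_le)
  have "((\<lambda>s. orbit_dist p S U s t0) \<longlongrightarrow> 0) (at_left t0)"
    by (rule tendsto_within_subset[OF t0(3)]) simp
  moreover have "filterlim (\<lambda>s. s - r) (at_left t0) (at_left t)"
    by (auto simp: filterlim_at r_def eventually_at_filter intro!: tendsto_eq_intros)
  ultimately have "((\<lambda>s. orbit_dist p S U (s - r) t0) \<longlongrightarrow> 0) (at_left t)"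
    by (rule filterlim_compose)
  then have "((\<lambda>s. M * orbit_dist p S U (s - r) t0) \<longlongrightarrow> 0) (at_left t)"
    by (rule tendsto_mult_right_zero)
  then show ?thesis
  proof (rule Lim_null_comparison[rotated])
    have "norm (orbit_dist p S U s t) \<le> M * orbit_dist p S U (s - r) t0" if "r < s" for s
      using M(2)[of "s - r" 1 "- 1"] that
      by (simp add: orbit_dist_def energy_norm_nonneg[OF p] r_def)
    then show "\<forall>\<^sub>F s in at_left t. norm (orbit_dist p S U s t) \<le> M * orbit_dist p S U (s - r) t0"
      using t0 by (intro eventually_at_leftI[of r]) (auto simp: r_def)
  qed
qed

text \<open>The reverse triangle inequality bounds the change of the norm by
  \<open>orbit_dist\<close>.\<close>

lemma energy_norm_orbit_left_tendsto:
  assumes p: "admissible p" and S: "c0_semigroup p S" and U: "U \<in> energy_space p" and "0 < t"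
  shows "((\<lambda>s. energy_norm p (S s U)) \<longlongrightarrow> energy_norm p (S t U)) (at_left t)"
proof -
  have le: "energy_norm p (S a U) \<le> orbit_dist p S U a b + energy_norm p (S b U)"
    if "0 \<le> a" "0 \<le> b" for a b
  proof -
    define X Y where "X = S a U" and "Y = S b U"
    have XY: "X \<in> energy_space p" "Y \<in> energy_space p"
      unfolding X_def Y_def by (intro c0_semigroup_mem[OF S U] that)+
    have "X = lincomb 1 (state_diff X Y) 1 Y"
      by (simp add: lincomb_def)
    then show ?thesis
      using energy_norm_lincomb[OF p energy_space_lincomb[OF XY, of 1 "- 1"] XY(2), of 1 1]
      by (simp add: orbit_dist_def X_def Y_def)
  qed
  have "((\<lambda>s. energy_norm p (S s U) - energy_norm p (S t U)) \<longlongrightarrow> 0) (at_left t)"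
    using orbit_dist_left_tendsto[OF assms]
  proof (rule Lim_null_comparison[rotated])
    have "norm (energy_norm p (S s U) - energy_norm p (S t U)) \<le> orbit_dist p S U s t"
      if "0 < s" for s
      using le[of s t] le[of t s] orbit_dist_sym[OF p S U, of s t] that \<open>0 < t\<close> by auto
    then show "\<forall>\<^sub>F s in at_left t. norm (energy_norm p (S s U) - energy_norm p (S t U))
        \<le> orbit_dist p S U s t"
      using \<open>0 < t\<close> by (intro eventually_at_leftI[of 0]) auto
  qed
  then show ?thesis
    by (rule LIM_zero_cancel)
qed

text \<open>The error made when the first-order expansion 1 + i\<omega>h is replaced by a number of
  modulus 1 is o(h).\<close>

lemma exp_ii_quotient_tendsto:
  "((\<lambda>h. cmod (1 + \<i> * of_real (\<omega> * h) - exp (\<i> * of_real (\<omega> * h))) / h) \<longlongrightarrow> 0) (at_right 0)"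
proof -
  have "((\<lambda>z. exp (\<i> * of_real \<omega> * z)) has_field_derivative \<i> * of_real \<omega>) (at 0)"
    by (auto intro!: derivative_eq_intros)
  then have "((\<lambda>z. (exp (\<i> * of_real \<omega> * z) - 1) / z) \<longlongrightarrow> \<i> * of_real \<omega>) (at 0)"
    by (simp add: DERIV_def)
  moreover have "filterlim (\<lambda>h. complex_of_real h) (at 0) (at_right 0)"
    by (auto simp: filterlim_at eventually_at_filter intro!: tendsto_eq_intros)
  ultimately have "((\<lambda>h. (exp (\<i> * of_real \<omega> * of_real h) - 1) / of_real h) \<longlongrightarrow> \<i> * of_real \<omega>)
      (at_right 0)"
    by (rule filterlim_compose)
  then have "((\<lambda>h. cmod (\<i> * of_real \<omega> - (exp (\<i> * of_real \<omega> * of_real h) - 1) / of_real h))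
      \<longlongrightarrow> cmod (\<i> * of_real \<omega> - \<i> * of_real \<omega>)) (at_right 0)"
    by (intro tendsto_intros)
  then have "((\<lambda>h. cmod (\<i> * of_real \<omega> - (exp (\<i> * of_real \<omega> * of_real h) - 1) / of_real h)) \<longlongrightarrow> 0)
      (at_right 0)"
    by simp
  then show ?thesis
  proof (rule Lim_transform_eventually)
    show "\<forall>\<^sub>F h in at_right 0.
        cmod (\<i> * of_real \<omega> - (exp (\<i> * of_real \<omega> * of_real h) - 1) / of_real h)
        = cmod (1 + \<i> * of_real (\<omega> * h) - exp (\<i> * of_real (\<omega> * h))) / h"
      using eventually_at_right_less
    proof eventually_elim
      case (elim h)
      then have "\<i> * of_real \<omega> - (exp (\<i> * of_real \<omega> * of_real h) - 1) / of_real h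
          = (1 + \<i> * of_real (\<omega> * h) - exp (\<i> * of_real (\<omega> * h))) / of_real h"
        by (simp add: field_simps)
      with elim show ?case
        by (simp add: norm_divide)
    qed
  qed
qed

text \<open>Up to an error \<open>h * R h\<close> in norm, with R tending to 0, the vector
  \<open>S h U\<close> equals \<open>e h\<close> times \<open>U\<close>. Shifting by t gives the
  same comparison between times t + h and t, and since \<open>e h\<close> has modulus 1 the two
  norms differ by o(h).\<close>

lemma energy_norm_orbit_eigenvector:
  assumes p: "admissible p" and gen: "generated_by_A p S"
    and U: "U \<in> energy_space p" "U \<in> dom_A p"
    and eig: "state_eq p (lincomb (\<i> * of_real \<omega>) U 0 U) (op_A p U)"
    and "0 \<le> t"
  shows "energy_norm p (S t U) = energy_norm p U"
proof -
  have S: "c0_semigroup p S"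
    using gen by (simp add: generated_by_A_def)
  \<comment> \<open>The scalar multiple i\<omega>U is written with a second coefficient 0, as
    \<open>lincomb\<close> is the available vector operation.\<close>
  define V where "V = lincomb (\<i> * of_real \<omega>) U 0 U"
  have V: "V \<in> energy_space p"
    unfolding V_def by (intro energy_space_lincomb U)
  define Q where "Q h = state_diff (lincomb (1 / of_real h) (S h U) (- 1 / of_real h) U) V" for h :: real
  have lim_Q: "((\<lambda>h. energy_norm p (Q h)) \<longlongrightarrow> 0) (at_right 0)"
    using gen U V eig unfolding generated_by_A_def V_def Q_def by blast
  define e where "e h = exp (\<i> * of_real (\<omega> * h))" for h :: real
  define R where "R h = energy_norm p (Q h)
      + cmod (1 + \<i> * of_real (\<omega> * h) - e h) / h * energy_norm p U" for h :: real
  have lim_R: "(R \<longlongrightarrow> 0 + 0 * energy_norm p U) (at_right 0)"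
    unfolding R_def e_def by (intro tendsto_intros lim_Q exp_ii_quotient_tendsto)
  have step: "energy_norm p (lincomb 1 (S h U) (- e h) U) \<le> h * R h" if "0 < h" for h
  proof -
    have Sh: "S h U \<in> energy_space p"
      using that by (intro c0_semigroup_mem[OF S U(1)]) simp
    have "Q h \<in> energy_space p"
      unfolding Q_def by (intro energy_space_lincomb Sh U V)
    \<comment> \<open>Multiplying \<open>Q h\<close> by h gives S h U - U - i\<omega>h U; the second
      summand replaces 1 + i\<omega>h by \<open>e h\<close>.\<close>
    moreover have "lincomb 1 (S h U) (- e h) U
        = lincomb (of_real h) (Q h) (1 + \<i> * of_real (\<omega> * h) - e h) U"
      using that by (simp add: Q_def V_def lincomb_def algebra_simps)
    ultimately have "energy_norm p (lincomb 1 (S h U) (- e h) U)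
        \<le> h * energy_norm p (Q h) + cmod (1 + \<i> * of_real (\<omega> * h) - e h) * energy_norm p U"
      using energy_norm_lincomb[OF p _ U(1), of "Q h" "of_real h" "1 + \<i> * of_real (\<omega> * h) - e h"] that
      by simp
    also have "\<dots> = h * R h"
      using that by (simp add: R_def field_simps)
    finally show ?thesis .
  qed
  have "energy_norm p (S t U) = energy_norm p (S 0 U)"
  proof (rule zero_right_derivative_imp_constant)
    fix t :: real assume "0 \<le> t"
    obtain M where M: "0 \<le> M" "\<And>h \<alpha> \<beta>. 0 \<le> h \<Longrightarrow>
        energy_norm p (lincomb \<alpha> (S (t + h) U) \<beta> (S (t + 0) U))
          \<le> M * energy_norm p (lincomb \<alpha> (S h U) \<beta> (S 0 U))"
      using c0_semigroup_shift[OF p S U(1) \<open>0 \<le> t\<close>] by (metis order_refl)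
    have "\<bar>energy_norm p (S (t + h) U) - energy_norm p (S t U)\<bar> \<le> M * (h * R h)" if "0 < h" for h
    proof -
      define X Y where "X = S (t + h) U" and "Y = S t U"
      have XY: "X \<in> energy_space p" "Y \<in> energy_space p"
        unfolding X_def Y_def using that \<open>0 \<le> t\<close> by (auto intro: c0_semigroup_mem[OF S U(1)])
      define D where "D = lincomb 1 X (- e h) Y"
      have D: "D \<in> energy_space p"
        unfolding D_def by (intro energy_space_lincomb XY)
      have norm_e: "cmod (e h) = 1"
        by (simp add: e_def)
      then have "e h \<noteq> 0" by auto
      have "X = lincomb 1 D (e h) Y"
        by (simp add: D_def lincomb_def)
      then have 1: "energy_norm p X \<le> energy_norm p D + energy_norm p Y"
        using energy_norm_lincomb[OF p D XY(2), of 1 "e h"] norm_e by simp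
      \<comment> \<open>The relation is solved for the earlier vector as well, because the bound on
        the norms must be two-sided; 1 / e h again has modulus 1.\<close>
      have "Y = lincomb (- 1 / e h) D (1 / e h) X"
        using \<open>e h \<noteq> 0\<close> by (simp add: D_def lincomb_def field_simps)
      then have 2: "energy_norm p Y \<le> energy_norm p D + energy_norm p X"
        using energy_norm_lincomb[OF p D XY(1), of "- 1 / e h" "1 / e h"] norm_e
        by (simp add: norm_divide)
      have "energy_norm p D \<le> M * energy_norm p (lincomb 1 (S h U) (- e h) (S 0 U))"
        using M(2)[of h 1 "- e h"] that by (simp add: D_def X_def Y_def)
      also have "\<dots> = M * energy_norm p (lincomb 1 (S h U) (- e h) U)"
        using c0_semigroup_lincomb_0[OF p S U(1), of h 1 "- e h"] that by simp
      also have "\<dots> \<le> M * (h * R h)"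
        by (intro mult_left_mono step that M)
      finally show ?thesis
        using 1 2 by (simp add: X_def Y_def)
    qed
    note bound = this
    have "((\<lambda>h. M * R h) \<longlongrightarrow> M * (0 + 0 * energy_norm p U)) (at_right 0)"
      by (intro tendsto_mult_left lim_R)
    then have "((\<lambda>h. M * R h) \<longlongrightarrow> 0) (at_right 0)"
      by simp
    then show "((\<lambda>h. (energy_norm p (S (t + h) U) - energy_norm p (S t U)) / h) \<longlongrightarrow> 0) (at_right 0)"
    proof (rule Lim_null_comparison[rotated])
      show "\<forall>\<^sub>F h in at_right 0.
          norm ((energy_norm p (S (t + h) U) - energy_norm p (S t U)) / h) \<le> M * R h"
        using eventually_at_right_less
      proof eventually_elim
        case (elim h)
        then show ?case
          using bound[of h] by (simp add: field_simps)
      qed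
    qed
  qed (use \<open>0 \<le> t\<close> in \<open>auto intro: energy_norm_orbit_left_tendsto[OF p S U(1)]\<close>)
  also have "\<dots> = energy_norm p U"
    by (intro energy_norm_cong p c0_semigroup_mem[OF S] U c0_semigroup_0[OF S U(1)] order_refl)
  finally show ?thesis .
qed


section \<open>The sine as a limit of test functions\<close>

text \<open>Dominated convergence with a constant majorant, which is integrable on a bounded
  interval.\<close>

lemma L2_norm_tendsto_0:
  assumes cont: "\<And>n. continuous_on UNIV (f n)"
    and bound: "\<And>n x. x \<in> {0<..<L} \<Longrightarrow> cmod (f n x) \<le> B"
    and lim: "\<And>x. x \<in> {0<..<L} \<Longrightarrow> (\<lambda>n. f n x) \<longlonglongrightarrow> 0"
  shows "(\<lambda>n. L2_norm L (f n)) \<longlonglongrightarrow> 0"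
proof -
  interpret finite_measure "intv L" by (rule finite_measure_intv)
  have "(\<lambda>n. LINT x|intv L. (cmod (f n x))\<^sup>2) \<longlonglongrightarrow> (LINT x|intv L. 0)"
  proof (rule integral_dominated_convergence[where w = "\<lambda>x. B\<^sup>2"])
    show "(\<lambda>x. (cmod (f n x))\<^sup>2) \<in> borel_measurable (intv L)" for n
      using continuous_measurable_intv[OF cont[of n]] by measurable
    show "AE x in intv L. (\<lambda>n. (cmod (f n x))\<^sup>2) \<longlonglongrightarrow> 0"
      using lim by (intro AE_I2 tendsto_eq_intros) (auto intro: tendsto_norm_zero)
    show "AE x in intv L. norm ((cmod (f n x))\<^sup>2) \<le> B\<^sup>2" for n
      using bound by (intro AE_I2) (auto intro!: power_mono)
  qed auto
  then have "(\<lambda>n. sqrt (LINT x|intv L. (cmod (f n x))\<^sup>2)) \<longlonglongrightarrow> sqrt 0"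
    by (intro tendsto_real_sqrt) simp
  then show ?thesis
    by (simp add: L2_norm_def)
qed

lemma sobolev_norm_1_classical:
  assumes "\<And>x. (f has_vector_derivative f' x) (at x)" "continuous_on UNIV f'"
  shows "sobolev_norm L 1 f = sqrt ((L2_norm L f)\<^sup>2 + (L2_norm L f')\<^sup>2)"
proof -
  note props = wderiv_props[OF continuous_L2[OF assms(2), of L] classical_weak_deriv[OF assms]]
  have "L2_norm L (wderiv L f) = L2_norm L f'"
    by (rule L2_norm_cong_AE[OF props(1) continuous_L2[OF assms(2)] props(3)])
  then show ?thesis
    by (simp add: sobolev_norm_def)
qed

lemma smooth_expr_continuous: "smooth_expr f \<Longrightarrow> continuous_on S f"
  by (intro continuous_at_imp_continuous_on ballI differentiable_imp_continuous_within
      smooth_expr_differentiable)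

lemma smooth_expr_sobolev: "smooth_expr f \<Longrightarrow> f \<in> sobolev L k"
  by (intro classical_sobolev smooth_expr_differentiable smooth_expr_continuous smooth_expr_iterate)

lemma zero_sobolev0: "(\<lambda>x. 0) \<in> sobolev0 L k"
proof -
  have z: "(\<lambda>x. 0) \<in> sobolev L k"
    by (rule smooth_expr_sobolev[OF smooth_expr.const])
  have "sobolev_norm L k (\<lambda>x. 0) = 0"
    \<comment> \<open>The iterated \<open>wderiv\<close> of 0 need not be literally 0; coefficients
      0 in the norm inequality bound the norm by 0 directly.\<close>
    using sobolev_norm_lincomb_sq_le[OF z z, of 0 0] by simp
  with z show ?thesis
    by (auto simp: sobolev0_def intro!: bexI[OF _ zero_test_fun])
qed

text \<open>Here c stands for n times the distance to an end point. The bound 2 will be the majorant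
  for dominated convergence, and the decay 4/c gives the pointwise limit; it follows from c - 1
  \<ge> c/2 and exp (-1/y) \<le> 1 for y > 0.\<close>

lemma weighted_flat_exp_bounds:
  assumes "0 < c"
  shows "0 \<le> c * flat_exp 2 (c - 1)" "c * flat_exp 2 (c - 1) \<le> 2"
    "2 \<le> c \<Longrightarrow> c * flat_exp 2 (c - 1) \<le> 4 / c"
proof -
  show "0 \<le> c * flat_exp 2 (c - 1)"
    using assms by (simp add: flat_exp_def)
  show "c * flat_exp 2 (c - 1) \<le> 2"
  proof (cases "1 < c")
    case True
    \<comment> \<open>In this variable the expression is (r + r^2) e^(-r), and 1 + r + r^2/2 \<le>
      e^r bounds it by 2.\<close>
    define r where "r = 1 / (c - 1)"
    have r: "0 < r" "c = 1 + 1 / r"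
      using True by (simp_all add: r_def)
    have "flat_exp 2 (c - 1) = exp (- r) * r\<^sup>2"
      using True by (simp add: flat_exp_def r_def power_divide)
    then have "c * flat_exp 2 (c - 1) = (1 + 1 / r) * (exp (- r) * r\<^sup>2)"
      using r(2) by simp
    also have "\<dots> = (r + r\<^sup>2) * exp (- r)"
      using r(1) by (simp add: power2_eq_square distrib_right)
    also have "\<dots> \<le> 2 * exp r * exp (- r)"
      using exp_lower_Taylor_quadratic[of r] r(1) by (intro mult_right_mono) auto
    also have "\<dots> = 2"
      by (simp add: mult.assoc exp_minus_inverse)
    finally show ?thesis .
  qed (simp add: flat_exp_def)
  assume "2 \<le> c"
  have "c * flat_exp 2 (c - 1) \<le> c * (1 / (c - 1)\<^sup>2)"
    using \<open>2 \<le> c\<close> by (intro mult_left_mono) (auto simp: flat_exp_def intro!: divide_right_mono)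
  also have "\<dots> \<le> c * (1 / (c / 2)\<^sup>2)"
    using \<open>2 \<le> c\<close> by (intro mult_left_mono divide_left_mono power_mono mult_pos_pos) auto
  also have "\<dots> = 4 / c"
    using \<open>2 \<le> c\<close> by (simp add: power2_eq_square)
  finally show "c * flat_exp 2 (c - 1) \<le> 4 / c" .
qed

lemma weighted_flat_exp_tendsto:
  assumes "0 < c"
  shows "(\<lambda>n. real n * c * flat_exp 2 (real n * c - 1)) \<longlonglongrightarrow> 0"
proof (rule Lim_null_comparison)
  have top: "filterlim (\<lambda>n. real n * c) at_top sequentially"
    using filterlim_at_top_mult_tendsto_pos[OF tendsto_const assms filterlim_real_sequentially] .
  then show "(\<lambda>n. 4 / (real n * c)) \<longlonglongrightarrow> 0"
    by (intro tendsto_divide_0[OF tendsto_const] filterlim_at_top_imp_at_infinity)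
  have "\<forall>\<^sub>F n in sequentially. 2 \<le> real n * c"
    using top unfolding filterlim_at_top by blast
  then show "\<forall>\<^sub>F n in sequentially.
      norm (real n * c * flat_exp 2 (real n * c - 1)) \<le> 4 / (real n * c)"
  proof eventually_elim
    case (elim n)
    then show ?case
      using weighted_flat_exp_bounds(1,3)[of "real n * c"] by simp
  qed
qed

section \<open>The first Dirichlet eigenfunction and its approximation by cutoffs\<close>

definition sine_mode :: "real \<Rightarrow> real \<Rightarrow> complex" where
  "sine_mode L x = of_real (sin (pi / L * x))"

definition cosine_mode :: "real \<Rightarrow> real \<Rightarrow> complex" where
  "cosine_mode L x = of_real (pi / L * cos (pi / L * x))"

lemma smooth_expr_modes: "smooth_expr (sine_mode L)" "smooth_expr (cosine_mode L)"
  unfolding sine_mode_def cosine_mode_def of_real_mult by (intro smooth_expr.intros)+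

lemma sine_mode_has_vderiv: "(sine_mode L has_vector_derivative cosine_mode L x) (at x)"
proof -
  have "((\<lambda>x. sin (k * x)) has_real_derivative k * cos (k * x)) (at x)" for k :: real
    by (auto intro!: derivative_eq_intros)
  then show ?thesis
    unfolding sine_mode_def[abs_def] cosine_mode_def by (rule has_vector_derivative_of_real)
qed

lemma cosine_mode_has_vderiv:
  "(cosine_mode L has_vector_derivative - of_real ((pi / L)\<^sup>2) * sine_mode L x) (at x)"
proof -
  have "((\<lambda>x. k * cos (k * x)) has_real_derivative - k\<^sup>2 * sin (k * x)) (at x)" for k :: real
    by (auto intro!: derivative_eq_intros simp: power2_eq_square)
  then show ?thesis
    unfolding sine_mode_def cosine_mode_def[abs_def] of_real_minus[symmetric] of_real_mult[symmetric]
    by (rule has_vector_derivative_of_real)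
qed

text \<open>Both come from |sin y| \<le> |y|, the second after reflecting the argument by sin y =
  sin (\<pi> - y).\<close>

lemma sin_mode_le:
  assumes "x \<in> {0<..<L}"
  shows "\<bar>sin (pi / L * x)\<bar> \<le> pi / L * x" "\<bar>sin (pi / L * x)\<bar> \<le> pi / L * (L - x)"
proof -
  have L: "0 < L" using assms by simp
  show "\<bar>sin (pi / L * x)\<bar> \<le> pi / L * x"
    using abs_sin_x_le_abs_x[of "pi / L * x"] assms L by (simp add: abs_mult)
  have "pi / L * (L - x) = pi - pi / L * x"
    using L by (simp add: right_diff_distrib)
  then have "sin (pi / L * x) = sin (pi / L * (L - x))"
    by simp
  then show "\<bar>sin (pi / L * x)\<bar> \<le> pi / L * (L - x)"
    using abs_sin_x_le_abs_x[of "pi / L * (L - x)"] assms L by (simp add: abs_mult)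
qed

text \<open>The product rule for \<open>cutoff 0 L n\<close>; the derivative of
  \<open>flat_exp 0\<close> is \<open>flat_exp 2\<close>, which explains the indices.\<close>

definition cutoff_deriv :: "real \<Rightarrow> nat \<Rightarrow> real \<Rightarrow> complex" where
  "cutoff_deriv L n x =
    of_real (real n * (flat_exp 2 (real n * x - 1) * flat_exp 0 (real n * (L - x) - 1)
      - flat_exp 0 (real n * x - 1) * flat_exp 2 (real n * (L - x) - 1)))"

lemma cutoff_0_eq:
  "cutoff 0 L n x = of_real (flat_exp 0 (real n * x - 1) * flat_exp 0 (real n * (L - x) - 1))"
  by (simp add: cutoff_def algebra_simps)

lemma cutoff_has_vderiv: "(cutoff 0 L n has_vector_derivative cutoff_deriv L n x) (at x)"
proof -
  have 1: "((\<lambda>x. flat_exp 0 (real n * x - 1)) has_real_derivative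
      flat_exp 2 (real n * x - 1) * real n) (at x)"
    using flat_exp_affine_has_derivative[of 0 "real n" "- 1" x] by (simp add: numeral_2_eq_2)
  have 2: "((\<lambda>x. flat_exp 0 (real n * (L - x) - 1)) has_real_derivative
      - (flat_exp 2 (real n * (L - x) - 1) * real n)) (at x)"
    using flat_exp_affine_has_derivative[of 0 "- real n" "real n * L - 1" x]
    by (simp add: algebra_simps numeral_2_eq_2)
  have "((\<lambda>x. flat_exp 0 (real n * x - 1) * flat_exp 0 (real n * (L - x) - 1)) has_real_derivative
      real n * (flat_exp 2 (real n * x - 1) * flat_exp 0 (real n * (L - x) - 1)
      - flat_exp 0 (real n * x - 1) * flat_exp 2 (real n * (L - x) - 1))) (at x)"
    by (rule DERIV_cong[OF DERIV_mult[OF 1 2]]) (simp add: algebra_simps)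
  from has_vector_derivative_of_real[OF this] show ?thesis
    by (simp only: cutoff_0_eq[abs_def] cutoff_deriv_def)
qed

text \<open>The derivative of the cutoff is of size \<open>n\<close> near the end points, which the linear vanishing
  of the sine there compensates.\<close>

lemma sine_cutoff_deriv_le:
  assumes "x \<in> {0<..<L}"
  shows "cmod (sine_mode L x * cutoff_deriv L n x)
    \<le> pi / L * (real n * x * flat_exp 2 (real n * x - 1)
      + real n * (L - x) * flat_exp 2 (real n * (L - x) - 1))"
proof -
  define A B where "A = flat_exp 2 (real n * x - 1)" and "B = flat_exp 2 (real n * (L - x) - 1)"
  define A0 B0 where "A0 = flat_exp 0 (real n * x - 1)" and "B0 = flat_exp 0 (real n * (L - x) - 1)"
  define \<sigma> where "\<sigma> = \<bar>sin (pi / L * x)\<bar>"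
  have nonneg: "0 \<le> A" "0 \<le> B" "0 \<le> A0" "0 \<le> B0" "A0 \<le> 1" "B0 \<le> 1" "0 \<le> \<sigma>"
    by (auto simp: A_def B_def A0_def B0_def \<sigma>_def flat_exp_def)
  have "cmod (sine_mode L x * cutoff_deriv L n x) = \<sigma> * (real n * \<bar>A * B0 - A0 * B\<bar>)"
    by (simp add: sine_mode_def cutoff_deriv_def A_def B_def A0_def B0_def \<sigma>_def norm_mult abs_mult
        del: of_real_mult of_real_diff)
  also have "\<bar>A * B0 - A0 * B\<bar> \<le> A + B"
  proof -
    have "A * B0 \<le> A" "A0 * B \<le> B" "0 \<le> A * B0" "0 \<le> A0 * B"
      using nonneg by (simp_all add: mult_left_le mult_left_le_one_le)
    then show ?thesis
      using nonneg by linarith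
  qed
  then have "\<sigma> * (real n * \<bar>A * B0 - A0 * B\<bar>) \<le> \<sigma> * (real n * (A + B))"
    using nonneg by (intro mult_left_mono) auto
  also have "\<dots> = \<sigma> * (real n * A) + \<sigma> * (real n * B)"
    by (simp add: algebra_simps)
  also have "\<dots> \<le> pi / L * x * (real n * A) + pi / L * (L - x) * (real n * B)"
    using sin_mode_le[OF assms] nonneg by (intro add_mono mult_right_mono) (auto simp: \<sigma>_def)
  finally have "cmod (sine_mode L x * cutoff_deriv L n x)
      \<le> pi / L * x * (real n * A) + pi / L * (L - x) * (real n * B)" .
  moreover have "k * x * (real n * A) + k * (L - x) * (real n * B)
      = k * (real n * x * A + real n * (L - x) * B)" for k
    by (simp add: algebra_simps)
  ultimately show ?thesis
    by (simp only: A_def B_def)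
qed

text \<open>The approximants are the sine times \<open>cutoff 0 L n\<close>. Both the remainder and
  its classical derivative stay bounded uniformly in n and tend to 0 at each point of (0,L), hence
  in \<open>L2_norm\<close>.\<close>

lemma sine_mode_sobolev0:
  assumes "0 < L"
  shows "sine_mode L \<in> sobolev0 L 1"
proof -
  define \<phi> where "\<phi> n x = sine_mode L x * cutoff 0 L n x" for n x
  define f where "f n x = sine_mode L x - \<phi> n x" for n x
  define f' where "f' n x = cosine_mode L x
      - (sine_mode L x * cutoff_deriv L n x + cosine_mode L x * cutoff 0 L n x)" for n x
  have test: "\<phi> n \<in> test_fun L" for n
    unfolding \<phi>_def by (intro cutoff_mult_test_fun smooth_expr_modes) auto
  have deriv: "(f n has_vector_derivative f' n x) (at x)" for n x
    unfolding f_def f'_def \<phi>_def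
    by (intro has_vector_derivative_diff has_vector_derivative_mult sine_mode_has_vderiv
        cutoff_has_vderiv)
  have cont_cutoff_deriv: "continuous_on UNIV (cutoff_deriv L n)" for n
  proof -
    have "vderiv (cutoff 0 L n) = cutoff_deriv L n"
      by (rule vderivI) (rule cutoff_has_vderiv)
    then show ?thesis
      using smooth_expr_continuous[OF smooth_expr_vderiv[OF smooth_expr_cutoff[of 0 L n]]] by simp
  qed
  have cont: "continuous_on UNIV (f n)" "continuous_on UNIV (f' n)" for n
    unfolding f_def f'_def \<phi>_def
    by (intro continuous_intros smooth_expr_continuous smooth_expr_modes smooth_expr_cutoff
        cont_cutoff_deriv)+
  have sine_le: "cmod (sine_mode L x) \<le> 1" for x
    by (simp add: sine_mode_def)
  have cosine_le: "cmod (cosine_mode L x) \<le> pi / L" for x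
  proof -
    have "cmod (cosine_mode L x) \<le> \<bar>pi / L\<bar> * 1"
      unfolding cosine_mode_def norm_of_real abs_mult by (intro mult_left_mono) auto
    with assms show ?thesis by simp
  qed
  have cut_le: "cmod (1 - cutoff 0 L n x) \<le> 2" for n x
    using norm_triangle_ineq4[of 1 "cutoff 0 L n x"] norm_cutoff_le[of 0 L n x] by simp
  have f_eq: "f n x = sine_mode L x * (1 - cutoff 0 L n x)" for n x
    by (simp add: f_def \<phi>_def algebra_simps)
  \<comment> \<open>The first summand tends to 0 because the cutoff tends to 1; the second is
    controlled by the product estimate \<open>sine_cutoff_deriv_le\<close>.\<close>
  have f'_eq: "f' n x = cosine_mode L x * (1 - cutoff 0 L n x) - sine_mode L x * cutoff_deriv L n x"
    for n x
    by (simp add: f'_def algebra_simps)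
  have cut_lim: "(\<lambda>n. 1 - cutoff 0 L n x) \<longlonglongrightarrow> 0" if "x \<in> {0<..<L}" for x
    using tendsto_diff[OF tendsto_const[of 1] cutoff_tendsto_indicator[of 0 L x]] that by simp
  have "(\<lambda>n. L2_norm L (f n)) \<longlonglongrightarrow> 0"
  proof (rule L2_norm_tendsto_0[OF cont(1)])
    show "cmod (f n x) \<le> 1 * 2" for n x
      unfolding f_eq norm_mult by (intro mult_mono sine_le cut_le) auto
    show "(\<lambda>n. f n x) \<longlonglongrightarrow> 0" if "x \<in> {0<..<L}" for x
      unfolding f_eq using cut_lim[OF that] by (rule tendsto_mult_right_zero)
  qed
  moreover have "(\<lambda>n. L2_norm L (f' n)) \<longlonglongrightarrow> 0"
  proof (rule L2_norm_tendsto_0[OF cont(2)])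
    fix x assume x: "x \<in> {0<..<L}"
    define R where "R n = pi / L * (real n * x * flat_exp 2 (real n * x - 1)
        + real n * (L - x) * flat_exp 2 (real n * (L - x) - 1))" for n
    have "R n \<le> pi / L * (2 + 2)" for n
    proof (cases "n = 0")
      case True
      then show ?thesis using assms by (simp add: R_def)
    next
      case False
      then show ?thesis
        unfolding R_def using assms x
        by (intro mult_left_mono add_mono weighted_flat_exp_bounds) auto
    qed
    then have "cmod (sine_mode L x * cutoff_deriv L n x) \<le> pi / L * (2 + 2)" for n
      by (rule order_trans[OF sine_cutoff_deriv_le[OF x, of n, folded R_def]])
    moreover have "cmod (cosine_mode L x * (1 - cutoff 0 L n x)) \<le> pi / L * 2" for n
      unfolding norm_mult using assms by (intro mult_mono cosine_le cut_le) auto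
    ultimately show "cmod (f' n x) \<le> pi / L * 2 + pi / L * (2 + 2)" for n
      unfolding f'_eq by (intro order_trans[OF norm_triangle_ineq4] add_mono)
    have "R \<longlonglongrightarrow> pi / L * (0 + 0)"
      unfolding R_def[abs_def] using x
      by (intro tendsto_mult_left tendsto_add weighted_flat_exp_tendsto) auto
    then have "R \<longlonglongrightarrow> 0"
      by simp
    then have "(\<lambda>n. sine_mode L x * cutoff_deriv L n x) \<longlonglongrightarrow> 0"
      by (rule Lim_null_comparison[OF always_eventually, rotated])
        (use sine_cutoff_deriv_le[OF x, folded R_def] in blast)
    from tendsto_diff[OF tendsto_mult_right_zero[OF cut_lim[OF x]] this]
    show "(\<lambda>n. f' n x) \<longlonglongrightarrow> 0"
      unfolding f'_eq by simp
  qed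
  ultimately have "(\<lambda>n. sqrt ((L2_norm L (f n))\<^sup>2 + (L2_norm L (f' n))\<^sup>2)) \<longlonglongrightarrow> sqrt (0\<^sup>2 + 0\<^sup>2)"
    by (intro tendsto_intros)
  then have lim: "(\<lambda>n. sobolev_norm L 1 (f n)) \<longlonglongrightarrow> 0"
    unfolding sobolev_norm_1_classical[OF deriv cont(2)] by simp
  have "\<exists>\<psi>\<in>test_fun L. sobolev_norm L 1 (\<lambda>x. sine_mode L x - \<psi> x) < \<epsilon>" if "0 < \<epsilon>" for \<epsilon>
  proof -
    obtain n where "sobolev_norm L 1 (f n) < \<epsilon>"
      using order_tendstoD(2)[OF lim \<open>0 < \<epsilon>\<close>] by (auto simp: eventually_sequentially)
    then show ?thesis
      using test[of n] by (intro bexI[of _ "\<phi> n"]) (auto simp: f_def[abs_def])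
  qed
  then show ?thesis
    using smooth_expr_sobolev[OF smooth_expr_modes(1)] by (simp add: sobolev0_def del: sobolev.simps)
qed


section \<open>The undamped mode\<close>

lemma scaled_sine_mode_sobolev0: "0 < L \<Longrightarrow> (\<lambda>x. c * sine_mode L x) \<in> sobolev0 L 1"
  using sobolev0_lincomb[OF sine_mode_sobolev0 zero_sobolev0, of L c 0] by simp

lemma scaled_sine_mode_sobolev: "(\<lambda>x. c * sine_mode L x) \<in> sobolev L k"
  by (intro smooth_expr_sobolev smooth_expr.times smooth_expr.const smooth_expr_modes)

lemma wderiv_scaled_sine_mode:
  "AE x in intv L. wderiv L (\<lambda>x. c * sine_mode L x) x = c * cosine_mode L x"
proof -
  have cont: "continuous_on UNIV (\<lambda>x. c * cosine_mode L x)"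
    by (intro smooth_expr_continuous smooth_expr.times smooth_expr.const smooth_expr_modes)
  show ?thesis
    by (rule wderiv_props(3)[OF continuous_L2[OF cont] classical_weak_deriv[OF _ cont]])
      (rule has_vector_derivative_mult_right[OF sine_mode_has_vderiv])
qed

lemma wderiv2_scaled_sine_mode:
  "AE x in intv L. wderiv L (wderiv L (\<lambda>x. c * sine_mode L x)) x
    = - of_real ((pi / L)\<^sup>2) * (c * sine_mode L x)"
proof -
  have sine: "(\<lambda>x. c * sine_mode L x) \<in> sobolev L (Suc (Suc 0))"
    by (rule scaled_sine_mode_sobolev)
  have "smooth_expr (\<lambda>x. c * cosine_mode L x)"
    by (intro smooth_expr.times smooth_expr.const smooth_expr_modes)
  then have cosine: "(\<lambda>x. c * cosine_mode L x) \<in> L2 L"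
    by (intro continuous_L2 smooth_expr_continuous)
  have "AE x in intv L. wderiv L (wderiv L (\<lambda>x. c * sine_mode L x)) x
      = wderiv L (\<lambda>x. c * cosine_mode L x) x"
    by (rule wderiv_cong_AE[OF wderiv_sobolev(1)[OF sine] cosine wderiv_scaled_sine_mode])
  moreover have "AE x in intv L. wderiv L (\<lambda>x. c * cosine_mode L x) x
      = c * (- of_real ((pi / L)\<^sup>2) * sine_mode L x)"
  proof -
    have cont: "continuous_on UNIV (\<lambda>x. c * (- of_real ((pi / L)\<^sup>2) * sine_mode L x))"
      by (intro smooth_expr_continuous smooth_expr.times smooth_expr.const smooth_expr_modes)
    show ?thesis
      by (rule wderiv_props(3)[OF continuous_L2[OF cont] classical_weak_deriv[OF _ cont]])
        (rule has_vector_derivative_mult_right[OF cosine_mode_has_vderiv])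
  qed
  ultimately show ?thesis
    by eventually_elim simp
qed

text \<open>The conclusion reproduces both hypotheses for the derivative, so the lemma can be
  applied repeatedly, up to the fourth derivative of the transverse displacement.\<close>

lemma wderiv_AE_zero:
  assumes "f \<in> L2 L" "AE x in intv L. f x = 0"
  shows "wderiv L f \<in> L2 L" "AE x in intv L. wderiv L f x = 0"
proof -
  have zero: "(\<lambda>x. 0) \<in> L2 L"
    by (intro continuous_L2 continuous_intros)
  have "AE x in intv L. 0 = f x"
    using assms(2) by eventually_elim simp
  moreover have "is_weak_deriv L (\<lambda>x. 0) (\<lambda>x. 0)"
    by (simp add: is_weak_deriv_def)
  ultimately have "is_weak_deriv L f (\<lambda>x. 0)"
    using is_weak_deriv_cong_AE[OF _ zero assms(1) zero zero] by simp
  from wderiv_props[OF zero this]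
  show "wderiv L f \<in> L2 L" "AE x in intv L. wderiv L f x = 0"
    by simp_all
qed

text \<open>The velocities are i\<omega> times the displacements. The factors 1 and -1 are kept
  explicit so that the facts about \<open>c * sine_mode L x\<close> match syntactically.\<close>

definition opposed_rotation :: "beam \<Rightarrow> real \<Rightarrow> state" where
  "opposed_rotation p \<omega> =
     \<lparr> u1 = (\<lambda>x. 0), v1 = (\<lambda>x. 0),
       y1 = (\<lambda>x. 1 * sine_mode (len p) x), z1 = (\<lambda>x. \<i> * of_real \<omega> * sine_mode (len p) x),
       w = (\<lambda>x. 0), psi = (\<lambda>x. 0),
       u3 = (\<lambda>x. 0), v3 = (\<lambda>x. 0),
       y3 = (\<lambda>x. - 1 * sine_mode (len p) x),
       z3 = (\<lambda>x. - (\<i> * of_real \<omega>) * sine_mode (len p) x) \<rparr>"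

lemma opposed_rotation_mem:
  assumes "0 < len p"
  shows "opposed_rotation p \<omega> \<in> energy_space p" "opposed_rotation p \<omega> \<in> dom_A p"
proof -
  let ?L = "len p"
  have zero: "(\<lambda>x. 0) \<in> sobolev ?L k" "(\<lambda>x. 0) \<in> sobolev0 ?L k" "(\<lambda>x. 0) \<in> L2 ?L" for k
    using zero_sobolev0 sobolev0_subset sobolev_subset_L2 by blast+
  have sine: "(\<lambda>x. c * sine_mode ?L x) \<in> sobolev ?L k" "(\<lambda>x. c * sine_mode ?L x) \<in> sobolev0 ?L 1"
    "(\<lambda>x. c * sine_mode ?L x) \<in> L2 ?L" for c k
    using scaled_sine_mode_sobolev[of c ?L] scaled_sine_mode_sobolev0[OF assms] sobolev_subset_L2
    by blast+
  show "opposed_rotation p \<omega> \<in> energy_space p"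
    unfolding energy_space_def opposed_rotation_def state.select_convs mem_Collect_eq
    by (intro conjI zero sine)
  show "opposed_rotation p \<omega> \<in> dom_A p"
    unfolding dom_A_def opposed_rotation_def state.select_convs mem_Collect_eq
    by (intro conjI IntI zero sine)
qed

text \<open>The hypothesis on \<omega> is the dispersion relation of the remaining wave equation:
  the second derivative contributes (\<pi>/L)^2 and the shear term of each outer layer contributes a
  restoring force G1 h1.\<close>

lemma opposed_rotation_eigenvector:
  assumes p: "admissible p" and undamped: "damp_b p = 0" "damp_e p = 0"
    and sym: "E1 p = E3 p" "rho1 p = rho3 p" "G1 p = G3 p" "I1 p = I3 p" "h1 p = h3 p"
    and \<omega>: "rho1 p * I1 p * \<omega>\<^sup>2 = E1 p * I1 p * (pi / len p)\<^sup>2 + G1 p * h1 p"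
  shows "state_eq p (lincomb (\<i> * of_real \<omega>) (opposed_rotation p \<omega>) 0 (opposed_rotation p \<omega>))
    (op_A p (opposed_rotation p \<omega>))"
proof -
  define U where "U = opposed_rotation p \<omega>"
  define L s where "L = len p" and "s = sine_mode L"
  have pos: "0 < L" "0 < rho1 p" "0 < I1 p"
    using p by (simp_all add: admissible_def L_def)
  have U: "U \<in> energy_space p"
    unfolding U_def using pos by (intro opposed_rotation_mem) (simp add: L_def)
  have fields [simp]: "u1 U = (\<lambda>x. 0)" "v1 U = (\<lambda>x. 0)" "y1 U = (\<lambda>x. 1 * s x)"
    "z1 U = (\<lambda>x. \<i> * of_real \<omega> * s x)" "w U = (\<lambda>x. 0)" "psi U = (\<lambda>x. 0)"
    "u3 U = (\<lambda>x. 0)" "v3 U = (\<lambda>x. 0)" "y3 U = (\<lambda>x. - 1 * s x)"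
    "z3 U = (\<lambda>x. - (\<i> * of_real \<omega>) * s x)"
    by (simp_all add: U_def opposed_rotation_def s_def L_def)
  have z0: "(\<lambda>x. 0) \<in> L2 L" "AE x in intv L. (\<lambda>x. 0 :: complex) x = 0"
    by (auto intro: continuous_L2)
  \<comment> \<open>The vanishing components still need their chosen derivatives evaluated: order 1
    for tension and shear, order 2 for the longitudinal displacements, order 4 for the transverse
    displacement.\<close>
  note z1 = wderiv_AE_zero[OF z0]
  note z2 = wderiv_AE_zero[OF z1]
  note z3 = wderiv_AE_zero[OF z2]
  note z4 = wderiv_AE_zero[OF z3]
  have tau: "AE x in intv L. tau p U x = 0"
    using z1(2) by eventually_elim (simp add: tau_def L_def[symmetric] sym)
  have "tau p U \<in> L2 L"
    using linear_obs_tau[of p] U by (simp add: linear_obs_def L_def)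
  note Dtau = wderiv_AE_zero(2)[OF this tau]
  have shear: "AE x in intv L. shear1 p U x = 1 * s x" "AE x in intv L. shear3 p U x = - 1 * s x"
    using z1(2) by (eventually_elim, simp add: shear1_def shear3_def L_def[symmetric])+
  have shear_L2: "shear1 p U \<in> L2 L" "shear3 p U \<in> L2 L"
    using linear_obs_shear[of p] U by (simp_all add: linear_obs_def L_def)
  have Dshear: "AE x in intv L. wderiv L (shear1 p U) x = 1 * cosine_mode L x"
    "AE x in intv L. wderiv L (shear3 p U) x = - 1 * cosine_mode L x"
  proof -
    have "AE x in intv L. wderiv L T x = c * cosine_mode L x"
      if "T \<in> L2 L" "AE x in intv L. T x = c * s x" for T c
    proof -
      have "AE x in intv L. c * s x = T x"
        using that(2) by eventually_elim simp
      then have "AE x in intv L. wderiv L (\<lambda>x. c * s x) x = wderiv L T x"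
        unfolding s_def by (rule wderiv_cong_AE[OF scaled_sine_mode_sobolev[of _ _ "Suc 0"] that(1)])
      with wderiv_scaled_sine_mode[of L c] show ?thesis
        unfolding s_def by eventually_elim simp
    qed
    from this[OF shear_L2(1) shear(1)] this[OF shear_L2(2) shear(2)]
    show "AE x in intv L. wderiv L (shear1 p U) x = 1 * cosine_mode L x"
      "AE x in intv L. wderiv L (shear3 p U) x = - 1 * cosine_mode L x" .
  qed
  have Ds: "AE x in intv L. wderiv L (wderiv L (\<lambda>x. c * s x)) x = - of_real ((pi / L)\<^sup>2) * (c * s x)"
    for c unfolding s_def by (rule wderiv2_scaled_sine_mode)
  have scale: "(1 / (rho1 p * I1 p)) * (E1 p * I1 p * (pi / L)\<^sup>2 + G1 p * h1 p) = \<omega>\<^sup>2"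
    using \<omega>[symmetric] pos by (simp add: L_def)
  have factor: "c *\<^sub>R (e *\<^sub>R (- of_real q * y) - g *\<^sub>R y) = - (of_real (c * (e * q + g)) * y)"
    for c e q g :: real and y :: complex
    by (simp add: scaleR_conv_of_real algebra_simps)
  \<comment> \<open>Stated for arbitrary y because \<open>z1\<close> needs it at the sine and
    \<open>z3\<close> at its negative.\<close>
  have eigen: "(1 / (rho1 p * I1 p)) *\<^sub>R
      ((E1 p * I1 p) *\<^sub>R (- of_real ((pi / L)\<^sup>2) * y) - (G1 p * h1 p) *\<^sub>R y)
      = \<i> * of_real \<omega> * (\<i> * of_real \<omega> * y)" for y
    unfolding factor scale by (simp add: power2_eq_square mult_ac)
  have "AE x in intv L. u1 (lincomb (\<i> * of_real \<omega>) U 0 U) x = u1 (op_A p U) x"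
    "AE x in intv L. y1 (lincomb (\<i> * of_real \<omega>) U 0 U) x = y1 (op_A p U) x"
    "AE x in intv L. w (lincomb (\<i> * of_real \<omega>) U 0 U) x = w (op_A p U) x"
    "AE x in intv L. u3 (lincomb (\<i> * of_real \<omega>) U 0 U) x = u3 (op_A p U) x"
    "AE x in intv L. y3 (lincomb (\<i> * of_real \<omega>) U 0 U) x = y3 (op_A p U) x"
    by (simp_all add: lincomb_def op_A_def Let_def)
  moreover have "AE x in intv L. v1 (lincomb (\<i> * of_real \<omega>) U 0 U) x = v1 (op_A p U) x"
    "AE x in intv L. v3 (lincomb (\<i> * of_real \<omega>) U 0 U) x = v3 (op_A p U) x"
    using z2(2) tau
    by (eventually_elim, simp add: lincomb_def op_A_def Let_def L_def[symmetric])+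
  moreover have "AE x in intv L. psi (lincomb (\<i> * of_real \<omega>) U 0 U) x = psi (op_A p U) x"
    using z4(2) Dshear Dtau
    by eventually_elim (simp add: lincomb_def op_A_def Let_def L_def[symmetric] sym)
  moreover have "AE x in intv L. z1 (lincomb (\<i> * of_real \<omega>) U 0 U) x = z1 (op_A p U) x"
    using Ds[of "1"] shear(1) tau
  proof eventually_elim
    case (elim x)
    have "z1 (op_A p U) x = (1 / (rho1 p * I1 p)) *\<^sub>R
        ((E1 p * I1 p) *\<^sub>R wderiv L (wderiv L (\<lambda>x. 1 * s x)) x + (h1 p / 2) *\<^sub>R tau p U x
          - (G1 p * h1 p) *\<^sub>R shear1 p U x - damp_b p *\<^sub>R z1 U x)"
      by (simp only: op_A_def Let_def state.select_convs fields L_def sym)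
    also have "\<dots> = (1 / (rho1 p * I1 p)) *\<^sub>R
        ((E1 p * I1 p) *\<^sub>R (- of_real ((pi / L)\<^sup>2) * (1 * s x)) - (G1 p * h1 p) *\<^sub>R (1 * s x))"
      by (simp only: elim undamped scaleR_zero_left scaleR_zero_right add_0_right diff_0_right)
    also have "\<dots> = \<i> * of_real \<omega> * (\<i> * of_real \<omega> * (1 * s x))"
      by (rule eigen)
    finally show ?case
      by (simp add: lincomb_def)
  qed
  moreover have "AE x in intv L. z3 (lincomb (\<i> * of_real \<omega>) U 0 U) x = z3 (op_A p U) x"
    using Ds[of "- 1"] shear(2) tau
  proof eventually_elim
    case (elim x)
    have "z3 (op_A p U) x = (1 / (rho1 p * I1 p)) *\<^sub>R
        ((E1 p * I1 p) *\<^sub>R wderiv L (wderiv L (\<lambda>x. - 1 * s x)) x + (h1 p / 2) *\<^sub>R tau p U x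
          - (G1 p * h1 p) *\<^sub>R shear3 p U x - damp_e p *\<^sub>R z3 U x)"
      by (simp only: op_A_def Let_def state.select_convs fields L_def sym)
    also have "\<dots> = (1 / (rho1 p * I1 p)) *\<^sub>R
        ((E1 p * I1 p) *\<^sub>R (- of_real ((pi / L)\<^sup>2) * (- 1 * s x)) - (G1 p * h1 p) *\<^sub>R (- 1 * s x))"
      by (simp only: elim undamped scaleR_zero_left scaleR_zero_right add_0_right diff_0_right)
    also have "\<dots> = \<i> * of_real \<omega> * (\<i> * of_real \<omega> * (- 1 * s x))"
      by (rule eigen)
    finally show ?case
      by (simp add: lincomb_def)
  qed
  ultimately show ?thesis
    by (simp only: state_eq_def U_def[symmetric] L_def[symmetric] ball_simps simp_thms)
qed

text \<open>The sine is positive throughout (0,L), so a vanishing norm would make the interval a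
  null set.\<close>

lemma L2_norm_scaled_sine_mode_nonzero:
  assumes "0 < L" "c \<noteq> 0"
  shows "L2_norm L (\<lambda>x. c * sine_mode L x) \<noteq> 0"
proof
  assume "L2_norm L (\<lambda>x. c * sine_mode L x) = 0"
  then have "(LINT x|intv L. (cmod (c * sine_mode L x))\<^sup>2) = 0"
    by (simp add: L2_norm_def)
  moreover have "integrable (intv L) (\<lambda>x. (cmod (c * sine_mode L x))\<^sup>2)"
    by (rule L2_sq_integrable[OF sobolev_subset_L2[OF scaled_sine_mode_sobolev]])
  ultimately have "AE x in intv L. (cmod (c * sine_mode L x))\<^sup>2 = 0"
    by (subst integral_nonneg_eq_0_iff_AE[symmetric]) auto
  moreover have "sine_mode L x \<noteq> 0" if "x \<in> {0<..<L}" for x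
  proof -
    have "0 < sin (pi / L * x)"
      using that assms by (intro sin_gt_zero) (auto simp: field_simps)
    then show ?thesis
      by (simp add: sine_mode_def)
  qed
  then have "AE x in intv L. sine_mode L x \<noteq> 0"
    by (intro AE_I2) auto
  ultimately have "AE x in intv L. False"
    by eventually_elim (use assms in auto)
  then have "ae_filter (intv L) = bot"
    by (simp add: trivial_limit_def)
  then have "emeasure (intv L) (space (intv L)) = 0"
    unfolding ae_filter_eq_bot_iff .
  then show False
    using assms by (simp add: emeasure_restrict_space)
qed

text \<open>The kinetic term of \<open>z1\<close> alone is positive when \<omega> is nonzero, and no
  other energy term is negative.\<close>

lemma energy_norm_opposed_rotation:
  assumes p: "admissible p" and "\<omega> \<noteq> 0"
  shows "0 < energy_norm p (opposed_rotation p \<omega>)"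
proof -
  define U where "U = opposed_rotation p \<omega>"
  have pos: "0 < len p" "0 < rho1 p" "0 < I1 p"
    using p by (simp_all add: admissible_def)
  have "energy_norm p U \<noteq> 0"
  proof
    assume "energy_norm p U = 0"
    then have "(\<Sum>(c, T)\<leftarrow>energy_terms p. c * (L2_norm (len p) (T U))\<^sup>2) = 0"
      using energy_norm_sq[OF p, of U] by simp
    moreover have "\<forall>x\<in>set (map (\<lambda>(c, T). c * (L2_norm (len p) (T U))\<^sup>2) (energy_terms p)). 0 \<le> x"
      using energy_terms_props(1)[OF p] by auto
    ultimately have "\<forall>x\<in>set (map (\<lambda>(c, T). c * (L2_norm (len p) (T U))\<^sup>2) (energy_terms p)). x = 0"
      by (subst (asm) sum_list_nonneg_eq_0_iff) auto
    then have "rho1 p * I1 p * (L2_norm (len p) (z1 U))\<^sup>2 = 0"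
      by (auto simp: energy_terms_def Let_def)
    then have "L2_norm (len p) (\<lambda>x. \<i> * of_real \<omega> * sine_mode (len p) x) = 0"
      using pos(2,3) by (simp add: U_def opposed_rotation_def)
    then show False
      using L2_norm_scaled_sine_mode_nonzero[OF pos(1), of "\<i> * of_real \<omega>"] \<open>\<omega> \<noteq> 0\<close> by simp
  qed
  then show ?thesis
    using energy_norm_nonneg[OF p, of U] by (simp add: U_def)
qed

theorem theorem2p5:
  fixes p :: beam and S :: "real \<Rightarrow> state \<Rightarrow> state"
  assumes "admissible p"
    and "damp_a p > 0" and "damp_d p > 0"
    and "damp_b p = 0" and "damp_c p = 0" and "damp_e p = 0"
    and "E1 p = E3 p" and "rho1 p = rho3 p" and "G1 p = G3 p" and "I1 p = I3 p" and "h1 p = h3 p"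
    and "generated_by_A p S"
  shows "\<not> strongly_stable p S"
proof
  assume stable: "strongly_stable p S"
  note p = \<open>admissible p\<close>
  have pos: "0 < len p" "0 < rho1 p" "0 < I1 p" "0 < E1 p" "0 < G1 p" "0 < h1 p"
    using p by (simp_all add: admissible_def)
  \<comment> \<open>The positive root of the dispersion relation; its positivity also makes the
    kinetic energy nonzero.\<close>
  define \<omega> where "\<omega> = sqrt ((E1 p * I1 p * (pi / len p)\<^sup>2 + G1 p * h1 p) / (rho1 p * I1 p))"
  have num: "0 < E1 p * I1 p * (pi / len p)\<^sup>2 + G1 p * h1 p"
    using pos by (intro add_pos_pos mult_pos_pos zero_less_power) auto
  have "0 < \<omega>"
    unfolding \<omega>_def using num pos by simp
  have "\<omega>\<^sup>2 = (E1 p * I1 p * (pi / len p)\<^sup>2 + G1 p * h1 p) / (rho1 p * I1 p)"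
    unfolding \<omega>_def using num pos by (intro real_sqrt_pow2) simp
  then have \<omega>: "rho1 p * I1 p * \<omega>\<^sup>2 = E1 p * I1 p * (pi / len p)\<^sup>2 + G1 p * h1 p"
    using pos by simp
  define U where "U = opposed_rotation p \<omega>"
  have U: "U \<in> energy_space p" "U \<in> dom_A p"
    unfolding U_def by (intro opposed_rotation_mem pos)+
  have "state_eq p (lincomb (\<i> * of_real \<omega>) U 0 U) (op_A p U)"
    unfolding U_def using assms by (intro opposed_rotation_eigenvector \<omega>)
  then have const: "energy_norm p (S t U) = energy_norm p U" if "0 \<le> t" for t
    using that by (intro energy_norm_orbit_eigenvector[OF p \<open>generated_by_A p S\<close> U])
  have "((\<lambda>t. energy_norm p (S t U)) \<longlongrightarrow> 0) at_top"
    using stable U(1) by (simp add: strongly_stable_def)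
  moreover have "((\<lambda>t. energy_norm p (S t U)) \<longlongrightarrow> energy_norm p U) at_top"
  proof (rule tendsto_eventually)
    show "\<forall>\<^sub>F t in at_top. energy_norm p (S t U) = energy_norm p U"
      using eventually_ge_at_top[of 0] by eventually_elim (rule const)
  qed
  ultimately have "energy_norm p U = 0"
    using tendsto_unique[OF trivial_limit_at_top_linorder] by metis
  then show False
    using energy_norm_opposed_rotation[OF p, of \<omega>] \<open>0 < \<omega>\<close> by (simp add: U_def)
qed

end
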